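(* There exist $P_1,P_2,N>0$ (in particular $P_1=1$, $P_2=5$, $N=5$) such that $\mathcal C_{\mathrm{PerfectPartialFB}}(P_1,P_2,N)$ contains a rate pair that does not belong to $\mathcal R_{\mathrm{CL}}(P_1,P_2,N)$; consequently $\mathcal R_{\mathrm{CL}}(P_1,P_2,N)\ne\mathcal C_{\mathrm{PerfectPartialFB}}(P_1,P_2,N)$ for these parameters.
   Context: Channel model (perfect partial feedback). Fix $P_1,P_2,N>0$. Messages $M_1,M_2$ are independent and uniform on finite sets $\mathcal M_1,\mathcal M_2$; $\{Z_t\}$ is IID $\mathcal N(0,N)$ independent of the messages; the output is $Y_t=X_{1,t}+X_{2,t}+Z_t$. Transmitter 1 has no feedback: $X_{1,t}=\varphi_{1,t}(M_1)$. Transmitter 2 observes the past outputs noise-free: $X_{2,t}=\varphi_{2,t}(M_2,Y_1,\dots,Y_{t-1})$. Encoders satisfy $\frac1n\sum_{t=1}^n\mathbb E[X_{\nu,t}^2]\le P_\nu$; the decoder is $\phi:\mathbb R^n\to\mathcal M_1\times\mathcal M_2$. $(R_1,R_2)$ is achievable if for every $\delta>0$ and all sufficiently large $n$ there is a blocklength-$n$ code with $\frac1n\log|\mathcal M_\nu|>R_\nu-\delta$ and error probability tending to $0$ as $n\to\infty$. $\mathcal C_{\mathrm{PerfectPartialFB}}(P_1,P_2,N)$ is the set of achievable pairs. Cover–Leung region: $\mathcal R_{\mathrm{CL}}(P_1,P_2,N)=\bigcup_{\rho_1,\rho_2\in[0,1]}\mathcal R_{\mathrm{CL}}^{(\rho_1,\rho_2)}(P_1,P_2,N)$,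 where $\mathcal R_{\mathrm{CL}}^{(\rho_1,\rho_2)}(P_1,P_2,N)$ is the set of nonnegative $(R_1,R_2)$ with $R_1\le\frac12\log(1+\frac{P_1(1-\rho_1^2)}{N})$, $R_2\le\frac12\log(1+\frac{P_2(1-\rho_2^2)}{N})$, $R_1+R_2\le\frac12\log(1+\frac{P_1+P_2+2\sqrt{P_1P_2}\rho_1\rho_2}{N})$. *)

theory Defs
  imports "HOL-Probability.Probability"
begin

text \<open>Gaussian MAC with perfect partial feedback (only transmitter 2 sees past outputs).
  Time indices are 0..n-1 (shifted from 1..n), messages are {..<msz1} and {..<msz2},
  logarithms are natural (the same base is used for rates and for the Cover-Leung region).\<close>

record fbcode =
  msz1 :: nat
  msz2 :: nat
  enc1 :: "nat \<Rightarrow> nat \<Rightarrow> real"                       \<comment> \<open>t, M1\<close>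
  enc2 :: "nat \<Rightarrow> nat \<Rightarrow> (nat \<Rightarrow> real) \<Rightarrow> real"      \<comment> \<open>t, M2, past outputs Y_0..Y_(t-1)\<close>
  dec  :: "(nat \<Rightarrow> real) \<Rightarrow> nat \<times> nat"                 \<comment> \<open>Y_0..Y_(n-1)\<close>

definition noise :: "real \<Rightarrow> nat \<Rightarrow> (nat \<Rightarrow> real) measure" where
  "noise N n = PiM {..<n} (\<lambda>_. density lborel (normal_density 0 (sqrt N)))"

fun outp :: "fbcode \<Rightarrow> nat \<Rightarrow> nat \<Rightarrow> (nat \<Rightarrow> real) \<Rightarrow> nat \<Rightarrow> (nat \<Rightarrow> real)" where
  "outp c a b z 0 = (\<lambda>_. 0)"
| "outp c a b z (Suc t) =
     (let y = outp c a b z t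
      in y(t := enc1 c t a + enc2 c t b (restrict y {..<t}) + z t))"

definition x2 :: "fbcode \<Rightarrow> nat \<Rightarrow> nat \<Rightarrow> (nat \<Rightarrow> real) \<Rightarrow> nat \<Rightarrow> real" where
  "x2 c a b z t = enc2 c t b (restrict (outp c a b z t) {..<t})"

text \<open>A valid blocklength-n code under power constraints P1, P2 (expectations over uniform
  messages and the noise).\<close>
definition valid_code :: "real \<Rightarrow> real \<Rightarrow> real \<Rightarrow> nat \<Rightarrow> fbcode \<Rightarrow> bool" where
  "valid_code P1 P2 N n c \<longleftrightarrow>
     msz1 c \<ge> 1 \<and> msz2 c \<ge> 1 \<and>
     (\<forall>t<n. \<forall>b<msz2 c. enc2 c t b \<in> borel_measurable (PiM {..<t} (\<lambda>_. borel))) \<and>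
     dec c \<in> measurable (PiM {..<n} (\<lambda>_. borel)) (count_space UNIV) \<and>
     (\<Sum>t<n. (\<Sum>a<msz1 c. (enc1 c t a)\<^sup>2) / real (msz1 c)) \<le> real n * P1 \<and>
     (\<Sum>t<n. \<Sum>a<msz1 c. \<Sum>b<msz2 c. \<integral>\<^sup>+ z. ennreal ((x2 c a b z t)\<^sup>2) \<partial>noise N n)
        \<le> ennreal (real n * real (msz1 c) * real (msz2 c) * P2)"

definition err_prob :: "real \<Rightarrow> nat \<Rightarrow> fbcode \<Rightarrow> real" where
  "err_prob N n c =
     (\<Sum>a<msz1 c. \<Sum>b<msz2 c.
        measure (noise N n)
          {z \<in> space (noise N n). dec c (restrict (outp c a b z n) {..<n}) \<noteq> (a, b)})
     / (real (msz1 c) * real (msz2 c))"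

definition achievable :: "real \<Rightarrow> real \<Rightarrow> real \<Rightarrow> real \<times> real \<Rightarrow> bool" where
  "achievable P1 P2 N R \<longleftrightarrow>
     (\<forall>\<delta>>0. \<exists>c :: nat \<Rightarrow> fbcode.
        (\<exists>n0. \<forall>n\<ge>n0. valid_code P1 P2 N n (c n) \<and>
                ln (real (msz1 (c n))) / real n > fst R - \<delta> \<and>
                ln (real (msz2 (c n))) / real n > snd R - \<delta>) \<and>
        (\<lambda>n. err_prob N n (c n)) \<longlonglongrightarrow> 0)"

definition C_PerfectPartialFB :: "real \<Rightarrow> real \<Rightarrow> real \<Rightarrow> (real \<times> real) set" where
  "C_PerfectPartialFB P1 P2 N = {R. fst R \<ge> 0 \<and> snd R \<ge> 0 \<and> achievable P1 P2 N R}"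

definition R_CL_rho :: "real \<Rightarrow> real \<Rightarrow> real \<Rightarrow> real \<Rightarrow> real \<Rightarrow> (real \<times> real) set" where
  "R_CL_rho P1 P2 N \<rho>1 \<rho>2 = {(R1, R2). R1 \<ge> 0 \<and> R2 \<ge> 0 \<and>
      R1 \<le> ln (1 + P1 * (1 - \<rho>1\<^sup>2) / N) / 2 \<and>
      R2 \<le> ln (1 + P2 * (1 - \<rho>2\<^sup>2) / N) / 2 \<and>
      R1 + R2 \<le> ln (1 + (P1 + P2 + 2 * sqrt (P1 * P2) * \<rho>1 * \<rho>2) / N) / 2}"

definition R_CL :: "real \<Rightarrow> real \<Rightarrow> real \<Rightarrow> (real \<times> real) set" where
  "R_CL P1 P2 N = (\<Union>\<rho>1\<in>{0..1}. \<Union>\<rho>2\<in>{0..1}. R_CL_rho P1 P2 N \<rho>1 \<rho>2)"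

end

theory Submission
  imports Defs "HOL-Real_Asymp.Real_Asymp"
begin

text \<open>Two consecutive channel uses are combined so that the channel splits into two independent
  single-user Gaussian channels. Transmitter 1 sends \<open>(4/5, 3/5) u\<close> and transmitter 2 sends
  \<open>(3/5, -4/5) v\<close> plus, in the second use, \<open>3/5\<close> times the first output. The receiver can subtract this
  feedback term, and projecting on the two orthogonal directions yields \<open>u\<close> and \<open>v\<close> in independent
  noise of variance 5. The feedback term is negatively correlated with \<open>-4/5 v\<close>, so transmitter 2 can afford
  \<open>v\<close> of power \<open>55/4\<close> instead of \<open>10\<close>, while \<open>u\<close> has power \<open>2\<close>. Good codes for both single-user
  channels (Feinstein's lemma with Gaussian inputs) give the rate pair
  \<open>(ln (1 + 2/5) / 4, ln (1 + (55/4)/5) / 4)\<close>. In the Cover-Leung region these two rates force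
  \<open>\<rho>1\<^sup>2 \<le> 0.085\<close> and \<open>\<rho>2\<^sup>2 \<le> 0.064\<close>, and then the sum-rate constraint fails.\<close>

subsection \<open>Gaussian product measures\<close>

abbreviation gauss :: "real \<Rightarrow> real measure" where
  "gauss N \<equiv> density lborel (\<lambda>x. ennreal (normal_density 0 (sqrt N) x))"

lemma prob_space_gauss: "0 < N \<Longrightarrow> prob_space (gauss N)"
  by (simp add: prob_space_normal_density)

lemma product_prob_space_gauss: "0 < N \<Longrightarrow> product_prob_space (\<lambda>_. gauss N)"
  by (simp add: prob_space_gauss product_prob_spaceI)

lemma prob_space_noise: "0 < N \<Longrightarrow> prob_space (noise N n)"
  unfolding noise_def by (intro prob_space_PiM prob_space_gauss)

lemma sets_noise [simp, measurable_cong]: "sets (noise N n) = sets (PiM {..<n} (\<lambda>_. borel))"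
  unfolding noise_def by (intro sets_PiM_cong) auto

lemma space_noise: "space (noise N n) = extensional {..<n}"
  by (simp add: noise_def space_PiM PiE_def)

text \<open>Variances of independent centred normals add. The form as an average of shifted noise
  over the input is the mixing identity that Feinstein's lemma asks for.\<close>

lemma gauss_convolution:
  assumes "0 < S" "0 < N" and [measurable]: "A \<in> sets borel"
  shows "(\<integral>\<^sup>+x. emeasure (gauss N) {z. x + z \<in> A} \<partial>gauss S) = emeasure (gauss (S + N)) A"
proof -
  interpret S: prob_space "gauss S" using assms by (intro prob_space_gauss)
  interpret N: prob_space "gauss N" using assms by (intro prob_space_gauss)
  have "gauss S \<star> gauss N = gauss (S + N)"
  proof (subst convolution_density)
    show "density lborel (\<lambda>x. \<integral>\<^sup>+ y. ennreal (normal_density 0 (sqrt S) (x - y)) *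
        ennreal (normal_density 0 (sqrt N) y) \<partial>lborel) = gauss (S + N)"
      using conv_normal_density_zero_mean[of "sqrt S" "sqrt N"] assms
      by (simp add: ennreal_mult'[symmetric])
  qed (use S.finite_measure_axioms N.finite_measure_axioms in auto)
  then have "emeasure (gauss (S + N)) A = emeasure (gauss S \<star> gauss N) A"
    by simp
  also have "\<dots> = (\<integral>\<^sup>+x. emeasure (gauss N) {z. z + x \<in> A} \<partial>gauss S)"
    by (rule convolution_emeasure) (use S.finite_measure_axioms N.finite_measure_axioms in auto)
  finally show ?thesis
    by (simp add: add.commute)
qed

lemma noise_shift_box:
  assumes "0 < N" and A: "\<And>i. i < n \<Longrightarrow> A i \<in> sets borel"
  shows "emeasure (noise N n) {z \<in> space (noise N n). (\<lambda>j\<in>{..<n}. x j + z j) \<in> Pi\<^sub>E {..<n} A} =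
    (\<Prod>i<n. emeasure (gauss N) {z. x i + z \<in> A i})"
proof -
  interpret product_prob_space "\<lambda>_. gauss N" "{..<n}"
    using assms by (intro product_prob_space_gauss)
  have "{z \<in> space (noise N n). (\<lambda>j\<in>{..<n}. x j + z j) \<in> Pi\<^sub>E {..<n} A} =
      Pi\<^sub>E {..<n} (\<lambda>i. {z. x i + z \<in> A i})"
    by (auto simp: space_noise PiE_def Pi_def extensional_def)
  moreover have "{z. x i + z \<in> A i} \<in> sets (gauss N)" if "i < n" for i
  proof -
    have [measurable]: "A i \<in> sets borel" using A that .
    have "{z \<in> space borel. x i + z \<in> A i} \<in> sets borel" by measurable
    then show ?thesis by simp
  qed
  ultimately show ?thesis
    unfolding noise_def by (subst emeasure_PiM[symmetric]) auto
qed

text \<open>The left-hand side is the law of a sum of two independent product Gaussians. A product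
  measure is determined by its values on boxes, and on boxes both sides factor into the
  one-dimensional convolution identity.\<close>

lemma noise_convolution:
  assumes "0 < S" "0 < N" and A[measurable]: "A \<in> sets (PiM {..<n} (\<lambda>_. borel))"
  shows "(\<integral>\<^sup>+x. emeasure (noise N n) {z \<in> space (noise N n). (\<lambda>j\<in>{..<n}. x j + z j) \<in> A} \<partial>noise S n) =
    emeasure (noise (S + N) n) A"
proof -
  interpret Nn: prob_space "noise N n" using assms by (intro prob_space_noise)
  interpret SN: product_prob_space "\<lambda>_. gauss (S + N)" "{..<n}"
    using assms by (intro product_prob_space_gauss) auto
  interpret S: product_prob_space "\<lambda>_. gauss S" "{..<n}"
    using assms by (intro product_prob_space_gauss)
  let ?add = "\<lambda>(x, z). \<lambda>j\<in>{..<n}. x j + z j :: real"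
  let ?D = "distr (noise S n \<Otimes>\<^sub>M noise N n) (PiM {..<n} (\<lambda>_. borel)) ?add"
  have [measurable]: "?add \<in> measurable (noise S n \<Otimes>\<^sub>M noise N n) (PiM {..<n} (\<lambda>_. borel))"
    by measurable
  have emD: "emeasure ?D B = (\<integral>\<^sup>+x. emeasure (noise N n)
      {z \<in> space (noise N n). (\<lambda>j\<in>{..<n}. x j + z j) \<in> B} \<partial>noise S n)"
    if [measurable]: "B \<in> sets (PiM {..<n} (\<lambda>_. borel))" for B
  proof -
    have "emeasure ?D B = emeasure (noise S n \<Otimes>\<^sub>M noise N n)
        (?add -` B \<inter> space (noise S n \<Otimes>\<^sub>M noise N n))"
      by (simp add: emeasure_distr)
    also have "\<dots> = (\<integral>\<^sup>+x. emeasure (noise N n)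
      (Pair x -` (?add -` B \<inter> space (noise S n \<Otimes>\<^sub>M noise N n))) \<partial>noise S n)"
      by (rule Nn.emeasure_pair_measure_alt) measurable
    also have "\<dots> = (\<integral>\<^sup>+x. emeasure (noise N n)
      {z \<in> space (noise N n). (\<lambda>j\<in>{..<n}. x j + z j) \<in> B} \<partial>noise S n)"
      by (intro nn_integral_cong arg_cong2[where f=emeasure]) (auto simp: space_pair_measure)
    finally show ?thesis .
  qed
  have "?D = noise (S + N) n"
    unfolding noise_def[of "S + N"]
  proof (rule SN.PiM_eqI)
    fix B :: "nat \<Rightarrow> real set" assume "\<And>i. i \<in> {..<n} \<Longrightarrow> B i \<in> sets (gauss (S + N))"
    then have B[measurable]: "B i \<in> sets borel" if "i < n" for i using that by auto
    have "emeasure ?D (Pi\<^sub>E {..<n} B) =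
        (\<integral>\<^sup>+x. (\<Prod>i<n. emeasure (gauss N) {z. x i + z \<in> B i}) \<partial>noise S n)"
      by (subst emD) (auto intro!: sets_PiM_I_finite B simp only: noise_shift_box[OF assms(2) B])
    also have "\<dots> = (\<Prod>i<n. \<integral>\<^sup>+x. emeasure (gauss N) {z. x + z \<in> B i} \<partial>gauss S)"
      unfolding noise_def[of S]
    proof (rule S.product_nn_integral_prod)
      fix i assume "i \<in> {..<n}"
      then have [measurable]: "B i \<in> sets borel" by (auto intro: B)
      interpret N: prob_space "gauss N" using assms by (intro prob_space_gauss)
      show "(\<lambda>x. emeasure (gauss N) {z. x + z \<in> B i}) \<in> borel_measurable (gauss S)"
        by measurable
    qed simp
    also have "\<dots> = (\<Prod>i<n. emeasure (gauss (S + N)) (B i))"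
      by (intro prod.cong gauss_convolution assms B) auto
    finally show "emeasure ?D (Pi\<^sub>E {..<n} B) = (\<Prod>i<n. emeasure (gauss (S + N)) (B i))" .
  qed (auto intro!: sets_PiM_cong)
  then show ?thesis
    using emD[OF A] by simp
qed

section \<open>Moments and energy concentration of Gaussian noise\<close>

lemma gauss_moment_even:
  assumes "0 < N"
  shows "has_bochner_integral (gauss N) (\<lambda>x. x ^ (2 * k)) (fact (2 * k) / ((2 / N) ^ k * fact k))"
  using normal_moment_even[of "sqrt N" 0 k] assms
  by (intro has_bochner_integral_density) auto

lemma gauss_moment_2:
  assumes "0 < N" shows "has_bochner_integral (gauss N) (\<lambda>x. x\<^sup>2) N"
  using gauss_moment_even[OF assms, of 1] assms by (simp add: fact_numeral)

lemma gauss_moment_1: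
  assumes "0 < N" shows "has_bochner_integral (gauss N) (\<lambda>x. x) 0"
  using normal_moment_odd[of "sqrt N" 0 0] assms
  by (intro has_bochner_integral_density) auto

lemma gauss_square_variance:
  assumes "0 < N" shows "has_bochner_integral (gauss N) (\<lambda>x. (x\<^sup>2 - N)\<^sup>2) (2 * N\<^sup>2)"
proof -
  interpret prob_space "gauss N" using assms by (intro prob_space_gauss)
  have 4: "has_bochner_integral (gauss N) (\<lambda>x. x ^ 4) (3 * N\<^sup>2)"
    using gauss_moment_even[OF assms, of 2] assms
    by (simp add: fact_numeral power2_eq_square field_simps)
  have c: "has_bochner_integral (gauss N) (\<lambda>x. N\<^sup>2) (N\<^sup>2)"
    using has_bochner_integral_integrable[of "gauss N" "\<lambda>x. N\<^sup>2"] prob_space by simp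
  have "has_bochner_integral (gauss N) (\<lambda>x. x ^ 4 - 2 * N * x\<^sup>2 + N\<^sup>2) (3 * N\<^sup>2 - 2 * N * N + N\<^sup>2)"
    by (intro has_bochner_integral_add has_bochner_integral_diff 4 c
        has_bochner_integral_mult_right gauss_moment_2 assms)
  then show ?thesis
    by (simp add: power2_eq_square algebra_simps power4_eq_xxxx)
qed

text \<open>Expanding the square, the off-diagonal terms vanish because \<open>g\<close> is centred
  and coordinates are independent; each of the \<open>card I\<close> diagonal terms contributes
  \<open>v\<close>.\<close>

lemma product_centered_second_moment:
  fixes g :: "'a \<Rightarrow> real" and v :: real
  assumes "prob_space M" "integrable M g" "(\<integral>x. g x \<partial>M) = 0" "has_bochner_integral M (\<lambda>x. (g x)\<^sup>2) v"
    and "finite I"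
  shows "has_bochner_integral (PiM I (\<lambda>_. M)) (\<lambda>w. (\<Sum>i\<in>I. g (w i))\<^sup>2) (card I * v)"
proof -
  interpret M: prob_space M by fact
  interpret product_prob_space "\<lambda>_. M" I
    by (intro product_prob_spaceI assms)
  \<comment> \<open>Written as a product over all coordinates \<open>k\<close>, with factor 1 away
    from \<open>i\<close> and \<open>j\<close>, the term \<open>g (w i) * g (w j)\<close> is in the
    form required by the product integral theorem. The case \<open>i = j\<close> is covered by the
    same formula.\<close>
  let ?h = "\<lambda>i j k x. (if k = i then g x else 1) * (if k = j then g x else 1)"
  have h: "has_bochner_integral M (?h i j k) (if i = j then (if k = i then v else 1) else if k = i \<or> k = j then 0 else 1)" for i j k
    using assms has_bochner_integral_integrable[of M "\<lambda>x. 1"]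
    by (auto simp: power2_eq_square has_bochner_integral_iff M.prob_space)
  have hi: "integrable M (?h i j k)" for i j k using h by (rule has_bochner_integral_iff[THEN iffD1, THEN conjunct1])
  have *: "has_bochner_integral (PiM I (\<lambda>_. M)) (\<lambda>w. g (w i) * g (w j)) (if i = j then v else 0)"
    if "i \<in> I" "j \<in> I" for i j
  proof -
    have eq: "(\<Prod>k\<in>I. ?h i j k (w k)) = g (w i) * g (w j)" for w
      using that \<open>finite I\<close> by (simp add: prod.distrib prod.delta)
    have "integral\<^sup>L (PiM I (\<lambda>_. M)) (\<lambda>w. \<Prod>k\<in>I. ?h i j k (w k)) = (\<Prod>k\<in>I. integral\<^sup>L M (?h i j k))"
      by (rule product_integral_prod) (use assms hi in auto)
    also have "\<dots> = (\<Prod>k\<in>I. (if i = j then (if k = i then v else 1) else if k = i \<or> k = j then 0 else 1))"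
      by (intro prod.cong has_bochner_integral_integral_eq h refl)
    also have "\<dots> = (if i = j then v else 0)"
      using that \<open>finite I\<close> by (auto simp: prod.delta intro!: prod_zero)
    finally have "integral\<^sup>L (PiM I (\<lambda>_. M)) (\<lambda>w. g (w i) * g (w j)) = (if i = j then v else 0)"
      by (simp only: eq)
    moreover have "integrable (PiM I (\<lambda>_. M)) (\<lambda>w. \<Prod>k\<in>I. ?h i j k (w k))"
      by (rule product_integrable_prod) (use assms hi in auto)
    ultimately show ?thesis by (simp only: has_bochner_integral_iff eq)
  qed
  have "has_bochner_integral (PiM I (\<lambda>_. M)) (\<lambda>w. \<Sum>i\<in>I. \<Sum>j\<in>I. g (w i) * g (w j)) (\<Sum>i\<in>I. \<Sum>j\<in>I. if i = j then v else 0)"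
    by (intro has_bochner_integral_sum *)
  then show ?thesis using \<open>finite I\<close>
    by (simp add: power2_eq_square sum_product)
qed

text \<open>Chebyshev's inequality: the centred energy has variance
  \<open>n * (2 * N\<^sup>2)\<close>, and dividing by \<open>(a * (n * N))\<^sup>2\<close> leaves a
  bound free of \<open>N\<close>.\<close>

lemma noise_energy_concentration:
  assumes "0 < N" "0 < a" "0 < n"
  shows "measure (noise N n) {z \<in> space (noise N n). a * (n * N) \<le> \<bar>(\<Sum>j<n. (z j)\<^sup>2) - n * N\<bar>} \<le> 2 / (a\<^sup>2 * n)"
proof -
  interpret prob_space "noise N n" using assms by (intro prob_space_noise)
  let ?X = "\<lambda>z. (\<Sum>j<n. (z j)\<^sup>2 - N)"
  interpret G: prob_space "gauss N" using assms by (intro prob_space_gauss)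
  have c: "integral\<^sup>L (gauss N) (\<lambda>x. N) = N" using G.prob_space by simp
  have 2: "has_bochner_integral (noise N n) (\<lambda>z. (?X z)\<^sup>2) (card {..<n} * (2 * N\<^sup>2))"
    unfolding noise_def
    by (rule product_centered_second_moment)
       (use assms gauss_moment_2[OF assms(1)] c gauss_square_variance[OF assms(1)] in
        \<open>auto simp: prob_space_gauss has_bochner_integral_iff\<close>)
  have "{z \<in> space (noise N n). a * (n * N) \<le> \<bar>(\<Sum>j<n. (z j)\<^sup>2) - n * N\<bar>} =
      {z \<in> space (noise N n). (a * (n * N))\<^sup>2 \<le> (?X z)\<^sup>2}"
    using assms by (auto simp: sum_subtractf abs_le_square_iff[symmetric])
  also have "measure (noise N n) \<dots> \<le> (\<integral>z. (?X z)\<^sup>2 \<partial>noise N n) / (a * (n * N))\<^sup>2"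
    using assms 2 by (intro integral_Markov_inequality_measure[where A="{}"]) (auto simp: has_bochner_integral_iff)
  also have "\<dots> = 2 / (a\<^sup>2 * n)"
    using has_bochner_integral_integral_eq[OF 2] assms
    by (simp add: power2_eq_square field_simps)
  finally show ?thesis .
qed

text \<open>The exponent is the information density of the pair \<open>(x, y)\<close>.\<close>

lemma gauss_likelihood_ratio:
  assumes "0 < S" "0 < N"
  shows "(\<integral>\<^sup>+y. ennreal (exp (ln (1 + S / N) / 2 + y\<^sup>2 / (2 * (S + N)) - (y - x)\<^sup>2 / (2 * N))) \<partial>gauss (S + N)) = 1"
proof -
  have "sqrt (S + N) = sqrt N * sqrt (1 + S / N)"
    using assms by (simp add: real_sqrt_mult[symmetric] field_simps)
  moreover have "exp (ln (1 + S / N) / 2) = sqrt (1 + S / N)"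
    using assms by (simp add: ln_sqrt[symmetric] add_pos_pos)
  ultimately have e: "exp (ln (1 + S / N) / 2) / sqrt (S + N) = 1 / sqrt N"
    using assms by (simp add: field_simps add_pos_pos)
  \<comment> \<open>The exponential is the ratio of the channel density given \<open>x\<close> to
    the output density. Multiplying by the output density therefore leaves a normal density around
    \<open>x\<close>, whose total mass is 1.\<close>
  have eq: "normal_density 0 (sqrt (S + N)) y *
      exp (ln (1 + S / N) / 2 + y\<^sup>2 / (2 * (S + N)) - (y - x)\<^sup>2 / (2 * N)) =
    normal_density x (sqrt N) y" (is "?l = _") for y
  proof -
    have n: "normal_density 0 (sqrt (S + N)) y = exp (- y\<^sup>2 / (2 * (S + N))) / (sqrt (2 * pi) * sqrt (S + N))"
      using assms by (simp add: normal_density_def real_sqrt_mult)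
    have e': "exp (ln (1 + S / N) / 2 + y\<^sup>2 / (2 * (S + N)) - (y - x)\<^sup>2 / (2 * N)) =
        exp (ln (1 + S / N) / 2) * exp (y\<^sup>2 / (2 * (S + N)) - (y - x)\<^sup>2 / (2 * N))"
      by (simp only: exp_add add_diff_eq[symmetric])
    have "?l = (exp (ln (1 + S / N) / 2) / sqrt (S + N)) / sqrt (2 * pi) *
       (exp (- y\<^sup>2 / (2 * (S + N))) * exp (y\<^sup>2 / (2 * (S + N)) - (y - x)\<^sup>2 / (2 * N)))"
      unfolding n e' by (simp only: times_divide_eq_left times_divide_eq_right divide_divide_eq_left mult_ac)
    also have "exp (- y\<^sup>2 / (2 * (S + N))) * exp (y\<^sup>2 / (2 * (S + N)) - (y - x)\<^sup>2 / (2 * N)) = exp (- (y - x)\<^sup>2 / (2 * N))"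
      by (simp add: exp_add[symmetric])
    finally show ?thesis unfolding e
      using assms by (simp add: normal_density_def real_sqrt_mult)
  qed
  have "(\<integral>\<^sup>+y. ennreal (exp (ln (1 + S / N) / 2 + y\<^sup>2 / (2 * (S + N)) - (y - x)\<^sup>2 / (2 * N))) \<partial>gauss (S + N))
      = (\<integral>\<^sup>+y. ennreal (normal_density 0 (sqrt (S + N)) y) *
          ennreal (exp (ln (1 + S / N) / 2 + y\<^sup>2 / (2 * (S + N)) - (y - x)\<^sup>2 / (2 * N))) \<partial>lborel)"
    by (rule nn_integral_density) measurable
  also have "\<dots> = (\<integral>\<^sup>+y. ennreal (normal_density x (sqrt N) y) \<partial>lborel)"
    by (simp only: ennreal_mult'[OF normal_density_nonneg, symmetric] eq)
  also have "\<dots> = 1"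
    using assms by (subst nn_integral_eq_integral) auto
  finally show ?thesis .
qed

subsection \<open>Coding for the Gaussian channel\<close>

text \<open>Feinstein's greedy construction. If no further codeword could be added, every typical set
  \<open>B x\<close> with \<open>x \<in> F\<close> would be covered up to probability \<open>1 - \<epsilon>\<close> by the decoding sets chosen
  so far; averaging over the input distribution \<open>Q\<close> shows that those sets then have too large a
  probability under the output distribution \<open>P\<close>.\<close>

lemma feinstein_code:
  fixes Q :: "'x measure" and P :: "'y measure" and W :: "'x \<Rightarrow> 'y measure"
  assumes Q: "prob_space Q" and P: "prob_space P"
    and W: "\<And>x. x \<in> space Q \<Longrightarrow> prob_space (W x)" "\<And>x. x \<in> space Q \<Longrightarrow> sets (W x) = sets P"
    and meas: "\<And>A. A \<in> sets P \<Longrightarrow> (\<lambda>x. measure (W x) A) \<in> borel_measurable Q"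
    and mix: "\<And>A. A \<in> sets P \<Longrightarrow> (\<integral>x. measure (W x) A \<partial>Q) = measure P A"
    and F: "F \<in> sets Q"
    and B: "\<And>x. x \<in> F \<Longrightarrow> B x \<in> sets P" "\<And>x. x \<in> F \<Longrightarrow> measure P (B x) \<le> \<beta>"
    and T: "T \<in> sets P" and \<delta>: "0 \<le> \<delta>"
    and typical: "\<And>x. x \<in> F \<Longrightarrow> 1 - measure (W x) T - \<delta> \<le> measure (W x) (B x)"
    and M: "real M * \<beta> + measure P T + \<delta> < \<epsilon> * measure Q F"
    and \<beta>: "0 \<le> \<beta>"
  shows "\<exists>x D. (\<forall>i<M. x i \<in> F \<and> D i \<in> sets P \<and> D i \<subseteq> B (x i) \<and> 1 - \<epsilon> \<le> measure (W (x i)) (D i)) \<and>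
    disjoint_family_on D {..<M}"
  using M
proof (induction M)
  case 0
  then show ?case by (auto simp: disjoint_family_on_def)
next
  case (Suc M)
  interpret Q: prob_space Q by fact
  interpret P: prob_space P by fact
  have M: "real M * \<beta> + measure P T + \<delta> < \<epsilon> * measure Q F"
    using Suc.prems \<beta> by (simp add: algebra_simps)
  obtain x D where xD: "\<And>i. i < M \<Longrightarrow> x i \<in> F \<and> D i \<in> sets P \<and> D i \<subseteq> B (x i) \<and> 1 - \<epsilon> \<le> measure (W (x i)) (D i)"
    and disj: "disjoint_family_on D {..<M}"
    using Suc.IH[OF M] by blast
  define U where "U = (\<Union>i<M. D i)"
  have U: "U \<in> sets P" unfolding U_def using xD by auto
  have "measure P U \<le> (\<Sum>i<M. measure P (D i))"
    unfolding U_def using xD by (intro P.finite_measure_subadditive_finite) auto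
  also have "\<dots> \<le> (\<Sum>i<M. \<beta>)"
  proof (rule sum_mono)
    fix i assume "i \<in> {..<M}"
    then have "x i \<in> F" "D i \<subseteq> B (x i)" using xD by auto
    then show "measure P (D i) \<le> \<beta>"
      using B by (meson P.finite_measure_mono order_trans)
  qed
  finally have PU: "measure P U \<le> real M * \<beta>" by simp
  have "\<exists>y\<in>F. 1 - \<epsilon> \<le> measure (W y) (B y - U)"
  proof (rule ccontr)
    assume "\<not> ?thesis"
    then have less: "measure (W y) (B y - U) < 1 - \<epsilon>" if "y \<in> F" for y
      using that by force
    \<comment> \<open>The probability of \<open>T\<close> is carried along for each input, since
      only its average over \<open>Q\<close>, namely \<open>measure P T\<close>, is
      controlled.\<close>
    have *: "\<epsilon> * indicator F y \<le> measure (W y) T + \<delta> + measure (W y) U" if y: "y \<in> space Q" for y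
    proof (cases "y \<in> F")
      case True
      interpret W: prob_space "W y" using W y by blast
      have sets: "sets (W y) = sets P" using W y by blast
      have "measure (W y) (B y) \<le> measure (W y) ((B y - U) \<union> U)"
        using B True U sets by (intro W.finite_measure_mono) auto
      also have "\<dots> \<le> measure (W y) (B y - U) + measure (W y) U"
        using B True U sets by (intro measure_Un_le) auto
      finally show ?thesis
        using typical[OF True] less[OF True] True by simp
    qed (use \<delta> in auto)
    have int: "integrable Q (\<lambda>y. measure (W y) A)" if A: "A \<in> sets P" for A
    proof (rule Q.integrable_const_bound[where B=1])
      show "AE y in Q. norm (measure (W y) A) \<le> 1"
        using W by (auto intro!: AE_I2 prob_space.prob_le_1)
    qed (use meas A in auto)
    have "\<epsilon> * measure Q F = (\<integral>y. \<epsilon> * indicator F y \<partial>Q)"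
      using F by simp
    also have "\<dots> \<le> (\<integral>y. measure (W y) T + \<delta> + measure (W y) U \<partial>Q)"
      using F T U int * by (intro integral_mono) (auto intro!: integrable_real_indicator simp: Q.emeasure_eq_measure)
    also have "\<dots> = measure P T + \<delta> + measure P U"
      using int T U mix Q.prob_space by simp
    finally show False using M PU by simp
  qed
  then obtain y where y: "y \<in> F" "1 - \<epsilon> \<le> measure (W y) (B y - U)" by blast
  show ?case
  proof (intro exI conjI)
    show "\<forall>i<Suc M. (x(M := y)) i \<in> F \<and> (D(M := B y - U)) i \<in> sets P \<and>
        (D(M := B y - U)) i \<subseteq> B ((x(M := y)) i) \<and>
        1 - \<epsilon> \<le> measure (W ((x(M := y)) i)) ((D(M := B y - U)) i)"
      using xD y U B by (auto simp: less_Suc_eq)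
    show "disjoint_family_on (D(M := B y - U)) {..<Suc M}"
      using disj unfolding disjoint_family_on_def U_def by (fastforce simp: less_Suc_eq)
  qed
qed

lemma measurable_shift [measurable]:
  "(\<lambda>z. \<lambda>j\<in>{..<n}. x j + z j :: real) \<in> measurable (PiM {..<n} (\<lambda>_. borel)) (PiM {..<n} (\<lambda>_. borel))"
  by measurable

text \<open>Change of measure: on the typical set the information density is at least
  \<open>n * (\<kappa> - a)\<close>, while its exponential has expectation 1 under the output law,
  so Markov's inequality bounds the probability of the set. This holds for every \<open>x\<close>,
  because typicality fixes both energies directly.\<close>

lemma noise_output_bound:
  assumes "0 < S" "0 < N" "0 \<le> a"
  defines "\<kappa> \<equiv> ln (1 + S / N) / 2"
  shows "measure (noise (S + N) n) {y \<in> space (noise (S + N) n).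
      \<bar>(\<Sum>j<n. (y j)\<^sup>2) - n * (S + N)\<bar> < a * (n * (S + N)) \<and> \<bar>(\<Sum>j<n. (y j - x j)\<^sup>2) - n * N\<bar> < a * (n * N)}
    \<le> exp (- (real n * (\<kappa> - a)))" (is "measure _ ?B \<le> _")
proof -
  let ?P = "noise (S + N) n"
  interpret prob_space ?P using assms by (intro prob_space_noise) auto
  interpret SN: product_prob_space "\<lambda>_. gauss (S + N)" "{..<n}"
    using assms by (intro product_prob_space_gauss) auto
  let ?i = "\<lambda>j y. \<kappa> + y\<^sup>2 / (2 * (S + N)) - (y - x j)\<^sup>2 / (2 * N)"
  have dom: "indicator ?B y \<le> ennreal (exp (- (real n * (\<kappa> - a)))) * (\<Prod>j<n. ennreal (exp (?i j (y j))))" for y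
  proof (cases "y \<in> ?B")
    case True
    have "(\<Sum>j<n. (y j)\<^sup>2) \<ge> (1 - a) * (n * (S + N))" "(\<Sum>j<n. (y j - x j)\<^sup>2) \<le> (1 + a) * (n * N)"
      using True by (auto simp: algebra_simps)
    then have "(\<Sum>j<n. (y j)\<^sup>2) / (2 * (S + N)) \<ge> (1 - a) * n / 2" "(\<Sum>j<n. (y j - x j)\<^sup>2) / (2 * N) \<le> (1 + a) * n / 2"
      using assms by (simp_all add: field_simps)
    \<comment> \<open>The two energy terms differ by at least
      \<open>(1 - a) * n / 2 - (1 + a) * n / 2 = - a * n\<close>.\<close>
    then have "real n * (\<kappa> - a) \<le> (\<Sum>j<n. ?i j (y j))"
      by (simp add: sum.distrib sum_subtractf sum_divide_distrib[symmetric] field_simps)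
    then have "1 \<le> exp (- (real n * (\<kappa> - a))) * exp (\<Sum>j<n. ?i j (y j))"
      by (simp add: exp_add[symmetric])
    also have "\<dots> = exp (- (real n * (\<kappa> - a))) * (\<Prod>j<n. exp (?i j (y j)))"
      by (simp add: exp_sum)
    finally have "ennreal 1 \<le> ennreal \<dots>" by (rule ennreal_leI)
    then show ?thesis using True
      by (simp add: ennreal_mult' prod_ennreal[symmetric] prod_nonneg)
  qed simp
  have [measurable]: "?B \<in> sets ?P" by measurable
  have "emeasure ?P ?B = (\<integral>\<^sup>+y. indicator ?B y \<partial>?P)"
    by (rule nn_integral_indicator[symmetric]) measurable
  also have "\<dots> \<le> (\<integral>\<^sup>+y. ennreal (exp (- (real n * (\<kappa> - a)))) * (\<Prod>j<n. ennreal (exp (?i j (y j)))) \<partial>?P)"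
    by (intro nn_integral_mono dom)
  also have "\<dots> = ennreal (exp (- (real n * (\<kappa> - a)))) * (\<integral>\<^sup>+y. (\<Prod>j<n. ennreal (exp (?i j (y j)))) \<partial>?P)"
    by (intro nn_integral_cmult) measurable
  also have "(\<integral>\<^sup>+y. (\<Prod>j<n. ennreal (exp (?i j (y j)))) \<partial>?P) = (\<Prod>j<n. \<integral>\<^sup>+y. ennreal (exp (?i j y)) \<partial>gauss (S + N))"
    unfolding noise_def by (intro SN.product_nn_integral_prod) auto
  also have "\<dots> = 1"
    using gauss_likelihood_ratio[OF assms(1,2)] by (simp add: \<kappa>_def)
  finally show ?thesis
    by (simp add: emeasure_eq_measure)
qed

lemma noise_component:
  fixes f :: "real \<Rightarrow> real"
  assumes "0 < N" "j < n" "has_bochner_integral (gauss N) f v"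
  shows "has_bochner_integral (noise N n) (\<lambda>z. f (z j)) v"
proof -
  interpret product_prob_space "\<lambda>_. gauss N" "{..<n}"
    using assms by (intro product_prob_space_gauss)
  have "has_bochner_integral (distr (PiM {..<n} (\<lambda>_. gauss N)) (gauss N) (\<lambda>x. x j)) f v"
    using assms by (subst PiM_component) auto
  moreover have "(\<lambda>x. x j) \<in> measurable (PiM {..<n} (\<lambda>_. gauss N)) (gauss N)"
    using assms by (intro measurable_component_singleton) auto
  moreover have "f \<in> borel_measurable (gauss N)"
    using assms(3) by (auto simp: has_bochner_integral_iff)
  ultimately show ?thesis
    unfolding noise_def by (auto simp: has_bochner_integral_iff integrable_distr_eq integral_distr)
qed

text \<open>Markov's inequality applied to the energy, whose mean is \<open>n * S'\<close>. The
  bound does not tend to 1, but Feinstein's lemma only needs the admissible inputs to have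
  probability bounded away from 0.\<close>

lemma noise_power_bound:
  assumes "0 < S'" "S' < S"
  shows "1 - S' / S \<le> measure (noise S' n) {x \<in> space (noise S' n). (\<Sum>j<n. (x j)\<^sup>2) \<le> n * S}"
proof (cases "n = 0")
  case True
  interpret prob_space "noise S' n" using assms by (intro prob_space_noise)
  show ?thesis using True assms prob_space by simp
next
  case False
  interpret prob_space "noise S' n" using assms by (intro prob_space_noise)
  have 2: "has_bochner_integral (noise S' n) (\<lambda>x. \<Sum>j<n. (x j)\<^sup>2) (\<Sum>j<n. S')"
    using assms by (intro has_bochner_integral_sum noise_component gauss_moment_2) auto
  have "measure (noise S' n) {x \<in> space (noise S' n). n * S \<le> (\<Sum>j<n. (x j)\<^sup>2)} \<le>
      (\<integral>x. (\<Sum>j<n. (x j)\<^sup>2) \<partial>noise S' n) / (n * S)"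
    using assms 2 False
    by (intro integral_Markov_inequality_measure[where A="{}"]) (auto simp: has_bochner_integral_iff intro!: sum_nonneg)
  also have "\<dots> = S' / S"
    using has_bochner_integral_integral_eq[OF 2] False by simp
  finally have "1 - S' / S \<le> 1 - measure (noise S' n) {x \<in> space (noise S' n). n * S \<le> (\<Sum>j<n. (x j)\<^sup>2)}"
    by simp
  also have "\<dots> = measure (noise S' n) (space (noise S' n) - {x \<in> space (noise S' n). n * S \<le> (\<Sum>j<n. (x j)\<^sup>2)})"
    by (intro prob_compl[symmetric]) measurable
  also have "\<dots> \<le> measure (noise S' n) {x \<in> space (noise S' n). (\<Sum>j<n. (x j)\<^sup>2) \<le> n * S}"
  proof (rule finite_measure_mono)
    show "{x \<in> space (noise S' n). (\<Sum>j<n. (x j)\<^sup>2) \<le> n * S} \<in> events" by measurable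
  qed auto
  finally show ?thesis .
qed

text \<open>Feinstein's lemma with Gaussian inputs of power \<open>S'\<close> slightly below the
  allowed \<open>S\<close>. The term \<open>4 / (a\<^sup>2 * n)\<close> collects two Chebyshev
  bounds, one for the energy of the output and one for that of the noise.\<close>

lemma awgn_code_size:
  assumes "0 < S'" "S' < S" "0 < N" "0 < a" "0 < n"
    and M: "real M * exp (- (real n * (ln (1 + S' / N) / 2 - a))) + 4 / (a\<^sup>2 * n) < \<epsilon> * (1 - S' / S)"
    and "0 \<le> \<epsilon>"
  shows "\<exists>x d. (\<forall>m<M. (\<Sum>j<n. (x m j)\<^sup>2) \<le> n * S) \<and>
    d \<in> measurable (PiM {..<n} (\<lambda>_. borel)) (count_space UNIV) \<and>
    (\<forall>m<M. measure (noise N n) {z \<in> space (noise N n). d (\<lambda>j\<in>{..<n}. x m j + z j) \<noteq> m} \<le> \<epsilon>)"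
proof -
  let ?Q = "noise S' n" and ?P = "noise (S' + N) n"
  let ?B = "PiM {..<n} (\<lambda>_. borel :: real measure)"
  define sh where "sh x z = (\<lambda>j\<in>{..<n}. x j + z j :: real)" for x z :: "nat \<Rightarrow> real"
  define W where "W x = distr (noise N n) ?B (sh x)" for x
  define F where "F = {x \<in> space ?Q. (\<Sum>j<n. (x j)\<^sup>2) \<le> n * S}"
  define T where "T = {y \<in> space ?P. a * (n * (S' + N)) \<le> \<bar>(\<Sum>j<n. (y j)\<^sup>2) - n * (S' + N)\<bar>}"
  define B where "B x = {y \<in> space ?P.
      \<bar>(\<Sum>j<n. (y j)\<^sup>2) - n * (S' + N)\<bar> < a * (n * (S' + N)) \<and> \<bar>(\<Sum>j<n. (y j - x j)\<^sup>2) - n * N\<bar> < a * (n * N)}"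
    for x :: "nat \<Rightarrow> real"
  define \<beta> where "\<beta> = exp (- (real n * (ln (1 + S' / N) / 2 - a)))"
  interpret Q: prob_space ?Q using assms by (intro prob_space_noise)
  interpret P: prob_space ?P using assms by (intro prob_space_noise) auto
  interpret N: prob_space "noise N n" using assms by (intro prob_space_noise)
  have sh[measurable]: "sh x \<in> measurable (noise N n) ?B" for x
    unfolding sh_def by measurable
  have sh_sets: "{z \<in> space (noise N n). sh x z \<in> A} \<in> sets (noise N n)" if "A \<in> sets ?P" for A x
    using measurable_sets[OF sh, of A x] that by (simp add: vimage_def Int_def conj_commute)
  have sh2: "(\<lambda>(x, z). sh x z) \<in> measurable (?Q \<Otimes>\<^sub>M noise N n) ?B"
    unfolding sh_def by measurable
  have W: "prob_space (W x)" "sets (W x) = sets ?P" for x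
    unfolding W_def by (auto intro!: N.prob_space_distr)
  have mW: "measure (W x) A = measure (noise N n) {z \<in> space (noise N n). sh x z \<in> A}"
    if "A \<in> sets ?P" for x A
    unfolding W_def using that by (simp add: measure_distr vimage_def Int_def conj_commute)
  have eW: "(\<integral>\<^sup>+x. ennreal (measure (W x) A) \<partial>?Q) = emeasure ?P A" if "A \<in> sets ?P" for A
    using noise_convolution[OF assms(1,3), of A n] that
    by (simp add: mW N.emeasure_eq_measure[symmetric] sh_def)
  have meas: "(\<lambda>x. measure (W x) A) \<in> borel_measurable ?Q" if A: "A \<in> sets ?P" for A
  proof -
    have [measurable]: "Measurable.pred (?Q \<Otimes>\<^sub>M noise N n) (\<lambda>(x, z). sh x z \<in> A)"
      using measurable_sets[OF sh2, of A] A
      by (auto simp: pred_def vimage_def Int_def conj_commute case_prod_beta)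
    have "(\<lambda>x. emeasure (noise N n) {z \<in> space (noise N n). sh x z \<in> A}) \<in> borel_measurable ?Q"
      by measurable
    then have "(\<lambda>x. enn2real (emeasure (noise N n) {z \<in> space (noise N n). sh x z \<in> A})) \<in> borel_measurable ?Q"
      by measurable
    then show ?thesis unfolding mW[OF A] unfolding measure_def .
  qed
  have PT: "measure ?P T \<le> 2 / (a\<^sup>2 * n)"
    unfolding T_def using assms by (intro noise_energy_concentration) auto
  have T_sets: "T \<in> sets ?P" and B_sets: "B x \<in> sets ?P" and F_sets: "F \<in> sets ?Q" for x
    unfolding T_def B_def F_def by measurable
  have "\<exists>x D. (\<forall>i<M. x i \<in> F \<and> D i \<in> sets ?P \<and> D i \<subseteq> B (x i) \<and> 1 - \<epsilon> \<le> measure (W (x i)) (D i)) \<and>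
    disjoint_family_on D {..<M}"
  proof (rule feinstein_code[where Q="?Q" and \<beta>=\<beta> and T=T and \<delta>="2 / (a\<^sup>2 * n)"])
    fix A assume A: "A \<in> sets ?P"
    have "(\<integral>x. measure (W x) A \<partial>?Q) = enn2real (\<integral>\<^sup>+x. ennreal (measure (W x) A) \<partial>?Q)"
      by (intro integral_eq_nn_integral meas A) auto
    also have "\<dots> = measure ?P A" using eW[OF A] by (simp add: measure_def)
    finally show "(\<integral>x. measure (W x) A \<partial>?Q) = measure ?P A" .
  next
    fix x assume "x \<in> F"
    show "measure ?P (B x) \<le> \<beta>"
      unfolding B_def \<beta>_def using assms by (intro noise_output_bound) auto
    let ?E = "{z \<in> space (noise N n). a * (n * N) \<le> \<bar>(\<Sum>j<n. (z j)\<^sup>2) - n * N\<bar>}"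
    have *: "{z \<in> space (noise N n). sh x z \<in> T} \<in> sets (noise N n)"
        "{z \<in> space (noise N n). sh x z \<in> B x} \<in> sets (noise N n)"
      by (rule sh_sets[OF T_sets], rule sh_sets[OF B_sets])
    have E: "?E \<in> sets (noise N n)" by measurable
    \<comment> \<open>Subtracting the codeword from the output recovers the noise, so an output
      outside \<open>B x\<close> is atypical in its own energy or in that of the noise.\<close>
    have cover: "space (noise N n) \<subseteq>
        {z \<in> space (noise N n). sh x z \<in> B x} \<union> ({z \<in> space (noise N n). sh x z \<in> T} \<union> ?E)"
    proof
      fix z assume z: "z \<in> space (noise N n)"
      have "sh x z \<in> space ?P" by (simp add: sh_def space_noise)
      moreover have "(\<Sum>j<n. (sh x z j - x j)\<^sup>2) = (\<Sum>j<n. (z j)\<^sup>2)"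
        by (simp add: sh_def)
      ultimately have "sh x z \<in> B x \<or> sh x z \<in> T \<or> z \<in> ?E"
        unfolding B_def T_def mem_Collect_eq using z by (metis not_less)
      then show "z \<in> {z \<in> space (noise N n). sh x z \<in> B x} \<union> ({z \<in> space (noise N n). sh x z \<in> T} \<union> ?E)"
        using z by blast
    qed
    have "1 = measure (noise N n) (space (noise N n))" using N.prob_space by simp
    also have "\<dots> \<le> measure (noise N n)
       ({z \<in> space (noise N n). sh x z \<in> B x} \<union> ({z \<in> space (noise N n). sh x z \<in> T} \<union> ?E))"
      by (rule N.finite_measure_mono[OF cover]) (intro sets.Un * E)
    also have "\<dots> \<le> measure (noise N n) {z \<in> space (noise N n). sh x z \<in> B x} +
       (measure (noise N n) {z \<in> space (noise N n). sh x z \<in> T} + measure (noise N n) ?E)"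
      by (intro order_trans[OF measure_Un_le] add_left_mono measure_Un_le sets.Un * E order_refl)
    also have "measure (noise N n) ?E \<le> 2 / (a\<^sup>2 * n)"
      using assms by (intro noise_energy_concentration) auto
    finally show "1 - measure (W x) T - 2 / (a\<^sup>2 * n) \<le> measure (W x) (B x)"
      unfolding mW[OF T_sets] mW[OF B_sets] by linarith
  next
    have "real M * \<beta> + measure ?P T + 2 / (a\<^sup>2 * n) \<le> real M * \<beta> + 4 / (a\<^sup>2 * n)"
      using PT by simp
    also have "\<dots> < \<epsilon> * (1 - S' / S)" using M by (simp add: \<beta>_def)
    also have "\<dots> \<le> \<epsilon> * measure ?Q F"
      unfolding F_def using assms by (intro mult_left_mono noise_power_bound) auto
    finally show "real M * \<beta> + measure ?P T + 2 / (a\<^sup>2 * n) < \<epsilon> * measure ?Q F" .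
  qed (use W meas Q.prob_space_axioms P.prob_space_axioms T_sets B_sets F_sets in \<open>auto simp: \<beta>_def\<close>)
  then obtain x D where xF: "\<And>i. i < M \<Longrightarrow> x i \<in> F" and D: "\<And>i. i < M \<Longrightarrow> D i \<in> sets ?P"
    and good: "\<And>i. i < M \<Longrightarrow> 1 - \<epsilon> \<le> measure (W (x i)) (D i)"
    and disj: "disjoint_family_on D {..<M}"
    by blast
  \<comment> \<open>Disjointness makes the index unique; \<open>LEAST\<close> picks it in a form
    with a ready measurability rule. The default 0 is harmless, since the error bound counts as
    correct only outputs that land in \<open>D m\<close>.\<close>
  define d where "d y = (if \<exists>i<M. y \<in> D i then (LEAST i. i < M \<and> y \<in> D i) else 0)" for y
  have d_eq: "d y = m" if "m < M" "y \<in> D m" for m y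
  proof -
    have uniq: "i = m" if "i < M \<and> y \<in> D i" for i
      using disj that \<open>m < M\<close> \<open>y \<in> D m\<close> unfolding disjoint_family_on_def by blast
    have "(LEAST i. i < M \<and> y \<in> D i) = m"
    proof (rule Least_equality)
      show "m < M \<and> y \<in> D m" using that by blast
    qed (use uniq in blast)
    moreover have "\<exists>i<M. y \<in> D i" using that by blast
    ultimately show ?thesis unfolding d_def by simp
  qed
  have pred: "Measurable.pred ?B (\<lambda>y. i < M \<and> y \<in> D i)" for i
  proof (cases "i < M")
    case True
    then have "D i \<in> sets ?B" using D by auto
    then show ?thesis using True by simp
  qed simp
  have d: "d \<in> measurable ?B (count_space UNIV)"
    unfolding d_def
    by (intro measurable_If measurable_Least measurable_const predE pred_intros_countable pred) simp
  have "measure (noise N n) {z \<in> space (noise N n). d (sh (x m) z) \<noteq> m} \<le> \<epsilon>" if m: "m < M" for m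
  proof -
    let ?G = "{z \<in> space (noise N n). sh (x m) z \<in> D m}"
    have G: "?G \<in> sets (noise N n)"
      using D[OF m] by (rule sh_sets)
    have "measure (noise N n) {z \<in> space (noise N n). d (sh (x m) z) \<noteq> m} \<le>
        measure (noise N n) (space (noise N n) - ?G)"
    proof (rule N.finite_measure_mono)
      show "space (noise N n) - ?G \<in> N.events" using G by (rule sets.compl_sets)
    qed (use d_eq[OF m] in blast)
    also have "\<dots> = 1 - measure (W (x m)) (D m)"
      using N.prob_compl[OF G] mW[OF D[OF m]] by simp
    finally show ?thesis using good[OF m] by simp
  qed
  then show ?thesis
    using xF d unfolding sh_def F_def by blast
qed

text \<open>By continuity of the capacity in the power, some \<open>S' < S\<close> still has
  capacity above \<open>R\<close>. Feinstein's bound then has an exponentially small part and a part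
  of order \<open>1 / n\<close>. The error bound holds for each message, not only on
  average.\<close>

lemma awgn_code:
  fixes S N R :: real
  assumes "0 < S" "0 < N" "0 \<le> R" "R < ln (1 + S / N) / 2"
  shows "\<exists>C. \<forall>\<^sub>F n in sequentially. \<exists>M x d. exp (n * R) \<le> real M \<and> (\<forall>m<M. (\<Sum>j<n. (x m j)\<^sup>2) \<le> n * S) \<and>
    d \<in> measurable (PiM {..<n} (\<lambda>_. borel)) (count_space UNIV) \<and>
    (\<forall>m<M. measure (noise N n) {z \<in> space (noise N n). d (\<lambda>j\<in>{..<n}. x m j + z j) \<noteq> m} \<le> C / n)"
proof -
  have "((\<lambda>s. ln (1 + s / N) / 2) \<longlongrightarrow> ln (1 + S / N) / 2) (at_left S)"
    using assms by (intro tendsto_intros) (auto simp: add_pos_pos)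
  then have "\<forall>\<^sub>F s in at_left S. R < ln (1 + s / N) / 2"
    using assms by (auto dest: order_tendstoD)
  moreover have "\<forall>\<^sub>F s in at_left S. s \<in> {0<..<S}"
    using assms by (intro eventually_at_leftI) auto
  ultimately have "\<forall>\<^sub>F s in at_left S. R < ln (1 + s / N) / 2 \<and> s \<in> {0<..<S}"
    by (rule eventually_conj)
  then obtain S' where S': "R < ln (1 + S' / N) / 2" "0 < S'" "S' < S"
    using eventually_happens'[of "at_left S"] by force
  define \<kappa> where "\<kappa> = ln (1 + S' / N) / 2"
  \<comment> \<open>Half of the rate gap goes into the typicality tolerance; the other half makes
    the number of messages times the typical-set bound at most
    \<open>2 * exp (- (n * a))\<close>.\<close>
  define a where "a = (\<kappa> - R) / 2"
  define q where "q = 1 - S' / S"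
  \<comment> \<open>In the numerator, 1 absorbs the exponentially small term, eventually below
    \<open>1 / n\<close>, and \<open>4 / a\<^sup>2\<close> the Chebyshev terms; dividing by
    \<open>q\<close> compensates for the probability of the admissible inputs.\<close>
  define C where "C = (4 / a\<^sup>2 + 1) / q"
  have a: "0 < a" "\<kappa> - a = R + a" using S' by (auto simp: a_def \<kappa>_def field_simps)
  have q: "0 < q" using S' by (simp add: q_def)
  have "\<forall>\<^sub>F n::nat in sequentially. 2 * exp (- (real n * a)) < 1 / n"
    using a(1) by real_asymp
  moreover have "\<forall>\<^sub>F n::nat in sequentially. 0 < n"
    by (rule eventually_gt_at_top)
  ultimately have "\<forall>\<^sub>F n in sequentially. \<exists>M x d. exp (n * R) \<le> real M \<and> (\<forall>m<M. (\<Sum>j<n. (x m j)\<^sup>2) \<le> n * S) \<and>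
    d \<in> measurable (PiM {..<n} (\<lambda>_. borel)) (count_space UNIV) \<and>
    (\<forall>m<M. measure (noise N n) {z \<in> space (noise N n). d (\<lambda>j\<in>{..<n}. x m j + z j) \<noteq> m} \<le> C / n)"
  proof eventually_elim
    case (elim n)
    define M where "M = nat \<lceil>exp (n * R)\<rceil>"
    have M: "exp (n * R) \<le> real M" "real M \<le> exp (n * R) + 1"
      using exp_gt_zero[of "n * R"] unfolding M_def by linarith+
    \<comment> \<open>This is where \<open>0 \<le> R\<close> enters: rounding up to an integer at
      most doubles the number of messages.\<close>
    have "1 \<le> exp (n * R)" using assms by simp
    then have "real M * exp (- (real n * (\<kappa> - a))) \<le> (2 * exp (n * R)) * exp (- (real n * (\<kappa> - a)))"
      using M by (intro mult_right_mono) (linarith, simp)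
    also have "\<dots> = 2 * exp (- (real n * a))"
      unfolding a(2) by (simp add: exp_add[symmetric] algebra_simps)
    finally have "real M * exp (- (real n * (\<kappa> - a))) + 4 / (a\<^sup>2 * n) < 1 / n + 4 / (a\<^sup>2 * n)"
      using elim by simp
    also have "\<dots> = C / n * q"
    proof -
      have "C * q = 4 / a\<^sup>2 + 1" using q by (simp add: C_def)
      then have "C / n * q = (4 / a\<^sup>2 + 1) / n" by (metis times_divide_eq_left)
      then show ?thesis by (simp add: add_divide_distrib)
    qed
    finally have *: "real M * exp (- (real n * (\<kappa> - a))) + 4 / (a\<^sup>2 * n) < C / n * q" .
    have "0 \<le> C / n" using q by (simp add: C_def)
    then show ?case
      using awgn_code_size[OF S'(2,3) assms(2) a(1) elim(2) *[unfolded \<kappa>_def q_def]] M(1) by blast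
  qed
  then show ?thesis by blast
qed

subsection \<open>The two-use feedback code\<close>

text \<open>Projecting each pair of noise samples on the unit vector \<open>(c, s)\<close> preserves
  the variance, and different pairs share no coordinate, so the projections are again IID. Nonzero
  \<open>c\<close> and \<open>s\<close> keep both summands nondegenerate normals, as the sum rule
  for normals demands.\<close>

lemma noise_rotation:
  assumes "0 < N" "c\<^sup>2 + s\<^sup>2 = 1" "c \<noteq> 0" "s \<noteq> 0" "0 < k" "2 * k \<le> n"
  shows "distr (noise N n) (PiM {..<k} (\<lambda>_. borel)) (\<lambda>z. \<lambda>j\<in>{..<k}. c * z (2 * j) + s * z (2 * j + 1)) = noise N k"
proof -
  interpret prob_space "noise N n" using assms by (intro prob_space_noise)
  have comp: "distr (noise N n) borel (\<lambda>z. z i) = gauss N" if "i < n" for i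
  proof -
    interpret product_prob_space "\<lambda>_. gauss N" "{..<n}"
      using assms by (intro product_prob_space_gauss)
    have "distr (noise N n) borel (\<lambda>z. z i) = distr (PiM {..<n} (\<lambda>_. gauss N)) (gauss N) (\<lambda>z. z i)"
      unfolding noise_def by (intro distr_cong) auto
    then show ?thesis using that by (simp add: PiM_component)
  qed
  have ind: "indep_vars (\<lambda>_. borel) (\<lambda>i z. z i) {..<n}"
  proof (subst indep_vars_iff_distr_eq_PiM')
    have "distr (noise N n) (PiM {..<n} (\<lambda>_. borel)) (\<lambda>x. \<lambda>i\<in>{..<n}. x i) = distr (noise N n) (noise N n) (\<lambda>x. x)"
      by (intro distr_cong) (auto simp: space_noise extensional_restrict)
    also have "\<dots> = (PiM {..<n} (\<lambda>_. gauss N))" by (simp add: distr_id2 noise_def)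
    also have "\<dots> = PiM {..<n} (\<lambda>i. distr (noise N n) borel (\<lambda>z. z i))"
      by (intro PiM_cong) (auto simp: comp)
    finally show "distr (noise N n) (PiM {..<n} (\<lambda>_. borel)) (\<lambda>x. \<lambda>i\<in>{..<n}. x i) =
      PiM {..<n} (\<lambda>i. distr (noise N n) borel (\<lambda>z. z i))" .
  qed (use assms in \<open>auto simp: lessThan_empty_iff\<close>)
  let ?Y = "\<lambda>j z. c * z (2 * j) + s * z (2 * j + 1) :: real"
  \<comment> \<open>Functions of disjoint blocks of independent variables are independent.\<close>
  have "indep_vars (\<lambda>j. PiM {2 * j, 2 * j + 1} (\<lambda>_. borel)) (\<lambda>j z. restrict (\<lambda>i. z i) {2 * j, 2 * j + 1}) {..<k}"
    by (rule indep_vars_restrict[OF ind]) (use assms in \<open>auto simp: disjoint_family_on_def double_not_eq_Suc_double Suc_double_not_eq_double\<close>)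
  then have "indep_vars (\<lambda>_. borel) (\<lambda>j z. ?Y j (restrict (\<lambda>i. z i) {2 * j, 2 * j + 1})) {..<k}"
    by (rule indep_vars_compose2) measurable
  then have ind2: "indep_vars (\<lambda>_. borel) ?Y {..<k}"
    by simp
  define \<alpha> where "\<alpha> i = (if even i then c else s)" for i :: nat
  have \<alpha>: "\<alpha> i \<noteq> 0" for i using assms by (simp add: \<alpha>_def)
  have nrm: "distr (noise N n) borel (?Y j) = gauss N" if "j < k" for j
  proof -
    let ?I = "{2 * j, 2 * j + 1}"
    have I: "i < n" if "i \<in> ?I" for i using that \<open>j < k\<close> assms by auto
    have "distributed (noise N n) lborel (\<lambda>z. \<Sum>i\<in>?I. \<alpha> i * z i)
        (normal_density (\<Sum>i\<in>?I. 0) (sqrt (\<Sum>i\<in>?I. (\<bar>\<alpha> i\<bar> * sqrt N)\<^sup>2)))"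
    proof (rule sum_indep_normal)
      show "indep_vars (\<lambda>i. borel) (\<lambda>i z. \<alpha> i * z i) ?I"
        by (rule indep_vars_subset[OF indep_vars_compose2[OF ind]]) (use I in auto)
      fix i assume i: "i \<in> ?I"
      have "distributed (noise N n) lborel (\<lambda>z. z i) (normal_density 0 (sqrt N))"
        unfolding distributed_def
      proof (intro conjI)
        show "distr (noise N n) lborel (\<lambda>z. z i) = gauss N"
          using comp[OF I[OF i]] by (simp cong: distr_cong)
        have "i \<in> {..<n}" using I[OF i] by simp
        then show "(\<lambda>z. z i) \<in> measurable (noise N n) lborel"
          by measurable
      qed auto
      from normal_density_affine[OF this, of "\<alpha> i" 0]
      show "distributed (noise N n) lborel (\<lambda>z. \<alpha> i * z i) (normal_density 0 (\<bar>\<alpha> i\<bar> * sqrt N))"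
        using assms \<alpha> by simp
    qed (use assms \<alpha> in auto)
    moreover have "(\<Sum>i\<in>?I. (\<bar>\<alpha> i\<bar> * sqrt N)\<^sup>2) = (c\<^sup>2 + s\<^sup>2) * N"
      using assms(1) by (simp add: \<alpha>_def power_mult_distrib distrib_right)
    moreover have "(\<Sum>i\<in>?I. \<alpha> i * z i) = ?Y j z" for z
      by (simp add: \<alpha>_def)
    ultimately have "distributed (noise N n) lborel (?Y j) (normal_density 0 (sqrt N))"
      using assms by simp
    then have "distr (noise N n) lborel (?Y j) = gauss N"
      by (rule distributed_distr_eq_density)
    then show ?thesis by (simp cong: distr_cong)
  qed
  have "(PiM {..<k} (\<lambda>j. distr (noise N n) borel (?Y j))) =
      distr (noise N n) (PiM {..<k} (\<lambda>_. borel)) (\<lambda>z. \<lambda>j\<in>{..<k}. ?Y j z)"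
  proof (rule indep_vars_iff_distr_eq_PiM'[THEN iffD1, OF _ _ ind2, symmetric])
    fix j assume "j \<in> {..<k}"
    then have "2 * j \<in> {..<n}" "2 * j + 1 \<in> {..<n}" using assms by auto
    then show "random_variable borel (?Y j)" by measurable
  qed (use assms in auto)
  moreover have "(PiM {..<k} (\<lambda>j. distr (noise N n) borel (?Y j))) = noise N k"
    unfolding noise_def[of N k] by (intro PiM_cong) (auto simp: nrm[simplified])
  ultimately show ?thesis by simp
qed

text \<open>Coordinate \<open>t\<close> is written once, in recursion step \<open>Suc t\<close>, and
  later steps leave it unchanged.\<close>

lemma outp_eq:
  "t < n \<Longrightarrow> outp c a b z n t = enc1 c t a + x2 c a b z t + z t"
  by (induction n) (auto simp: Let_def x2_def less_Suc_eq)

text \<open>The feedback coefficient \<open>3/5\<close> is a rational close to the one minimising the power of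
  transmitter 2. The sign \<open>\<sigma>\<close> makes the correlation of the two codebook means favourable.\<close>

definition pair_code :: "real \<Rightarrow> nat \<Rightarrow> nat \<Rightarrow> nat \<Rightarrow> (nat \<Rightarrow> nat \<Rightarrow> real) \<Rightarrow> (nat \<Rightarrow> nat \<Rightarrow> real) \<Rightarrow>
    ((nat \<Rightarrow> real) \<Rightarrow> nat) \<Rightarrow> ((nat \<Rightarrow> real) \<Rightarrow> nat) \<Rightarrow> fbcode" where
  "pair_code \<sigma> k M1 M2 u v d1 d2 =
    \<lparr>msz1 = M1, msz2 = M2,
     enc1 = (\<lambda>t a. if t < 2 * k then (if even t then 4 / 5 else 3 / 5) * (\<sigma> * u a (t div 2)) else 0),
     enc2 = (\<lambda>t b y. if t < 2 * k then
       (if even t then 3 / 5 * v b (t div 2) else - 4 / 5 * v b (t div 2) + 3 / 5 * y (t - 1)) else 0),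
     dec = (\<lambda>y. (d1 (\<lambda>j\<in>{..<k}. \<sigma> * (4 / 5 * y (2 * j) + 3 / 5 * (y (2 * j + 1) - 3 / 5 * y (2 * j)))),
                 d2 (\<lambda>j\<in>{..<k}. 3 / 5 * y (2 * j) - 4 / 5 * (y (2 * j + 1) - 3 / 5 * y (2 * j)))))\<rparr>"

context
  fixes \<sigma> :: real and k M1 M2 :: nat and u v :: "nat \<Rightarrow> nat \<Rightarrow> real" and d1 d2 :: "(nat \<Rightarrow> real) \<Rightarrow> nat"
begin

abbreviation (input) "pc \<equiv> pair_code \<sigma> k M1 M2 u v d1 d2"

lemma pair_code_sel:
  "msz1 pc = M1" "msz2 pc = M2"
  "enc1 pc t a = (if t < 2 * k then (if even t then 4 / 5 else 3 / 5) * (\<sigma> * u a (t div 2)) else 0)"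
  "enc2 pc t b y = (if t < 2 * k then
     (if even t then 3 / 5 * v b (t div 2) else - 4 / 5 * v b (t div 2) + 3 / 5 * y (t - 1)) else 0)"
  by (simp_all add: pair_code_def)

text \<open>The first output of a pair contains \<open>3 / 5\<close> of \<open>v\<close>, so feeding
  back \<open>3 / 5\<close> of that output adds \<open>9 / 25\<close> to the coefficient
  \<open>- 20 / 25\<close>. The remaining \<open>- 11 / 25\<close> is the power saving that feedback
  buys, at the price of the terms in \<open>u\<close> and \<open>z\<close>.\<close>

lemma pair_code_x2:
  "x2 pc a b z (2 * j) = (if j < k then 3 / 5 * v b j else 0)"
  "x2 pc a b z (2 * j + 1) = (if j < k then 12 / 25 * \<sigma> * u a j - 11 / 25 * v b j + 3 / 5 * z (2 * j) else 0)"
proof -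
  show *: "x2 pc a b z (2 * j) = (if j < k then 3 / 5 * v b j else 0)"
    by (simp add: x2_def pair_code_sel)
  have "outp pc a b z (2 * j + 1) (2 * j) = 4 / 5 * (\<sigma> * u a j) + 3 / 5 * v b j + z (2 * j)" if "j < k"
    using that by (subst outp_eq) (auto simp: * pair_code_sel)
  then show "x2 pc a b z (2 * j + 1) = (if j < k then 12 / 25 * \<sigma> * u a j - 11 / 25 * v b j + 3 / 5 * z (2 * j) else 0)"
    by (auto simp: x2_def pair_code_sel algebra_simps)
qed

text \<open>Removing \<open>3 / 5\<close> of the first output from the second leaves
  \<open>\<sigma> * u\<close> along \<open>(4/5, 3/5)\<close> plus \<open>v\<close> along
  \<open>(3/5, -4/5)\<close> plus raw noise. These directions are orthonormal, so each projection
  eliminates the other user; a further factor \<open>\<sigma>\<close> undoes the sign.\<close>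

lemma pair_code_dec:
  assumes "\<sigma>\<^sup>2 = 1" "2 * k \<le> n"
  shows "dec pc (restrict (outp pc a b z n) {..<n}) =
    (d1 (\<lambda>j\<in>{..<k}. u a j + (\<sigma> * (4 / 5) * z (2 * j) + \<sigma> * (3 / 5) * z (2 * j + 1))),
     d2 (\<lambda>j\<in>{..<k}. v b j + (3 / 5 * z (2 * j) + - 4 / 5 * z (2 * j + 1))))"
proof -
  have e: "outp pc a b z n (2 * j) = 4 / 5 * (\<sigma> * u a j) + 3 / 5 * v b j + z (2 * j)"
    "outp pc a b z n (2 * j + 1) = 3 / 5 * (\<sigma> * u a j) + (12 / 25 * \<sigma> * u a j - 11 / 25 * v b j + 3 / 5 * z (2 * j)) + z (2 * j + 1)"
    if "j < k" for j
  proof -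
    have l: "2 * j < n" "2 * j + 1 < n" using that assms by auto
    show "outp pc a b z n (2 * j) = 4 / 5 * (\<sigma> * u a j) + 3 / 5 * v b j + z (2 * j)"
      "outp pc a b z n (2 * j + 1) = 3 / 5 * (\<sigma> * u a j) + (12 / 25 * \<sigma> * u a j - 11 / 25 * v b j + 3 / 5 * z (2 * j)) + z (2 * j + 1)"
      unfolding l[THEN outp_eq] pair_code_x2 using that by (auto simp: pair_code_sel)
  qed
  let ?y = "restrict (outp pc a b z n) {..<n}"
  have y: "?y (2 * j) = outp pc a b z n (2 * j)" "?y (2 * j + 1) = outp pc a b z n (2 * j + 1)" if "j < k" for j
    using that assms by auto
  have \<sigma>: "\<sigma> * (\<sigma> * x) = x" for x
    using assms(1) by (simp add: power2_eq_square mult.assoc[symmetric])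
  have "\<sigma> * (4 / 5 * ?y (2 * j) + 3 / 5 * (?y (2 * j + 1) - 3 / 5 * ?y (2 * j))) =
      u a j + (\<sigma> * (4 / 5) * z (2 * j) + \<sigma> * (3 / 5) * z (2 * j + 1))" if "j < k" for j
    unfolding y[OF that] e[OF that] by (simp add: \<sigma> algebra_simps)
  moreover have "3 / 5 * ?y (2 * j) - 4 / 5 * (?y (2 * j + 1) - 3 / 5 * ?y (2 * j)) =
      v b j + (3 / 5 * z (2 * j) + - 4 / 5 * z (2 * j + 1))" if "j < k" for j
    unfolding y[OF that] e[OF that] by (simp add: algebra_simps)
  ultimately show ?thesis
    unfolding pair_code_def fbcode.simps by (auto intro!: arg_cong[where f=d1] arg_cong[where f=d2])
qed

text \<open>By the union bound over the two decoders, only the law of each projected noise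
  separately enters, and \<open>noise_rotation\<close> identifies it with the noise of the
  single-user code.\<close>

lemma pair_code_err_prob:
  assumes \<sigma>: "\<sigma>\<^sup>2 = 1" and k: "2 * k \<le> n" "0 < k" and N: "0 < N" and M: "0 < M1" "0 < M2"
    and d1: "d1 \<in> measurable (PiM {..<k} (\<lambda>_. borel)) (count_space UNIV)"
    and d2: "d2 \<in> measurable (PiM {..<k} (\<lambda>_. borel)) (count_space UNIV)"
    and e1: "\<And>m. m < M1 \<Longrightarrow> measure (noise N k) {z \<in> space (noise N k). d1 (\<lambda>j\<in>{..<k}. u m j + z j) \<noteq> m} \<le> \<epsilon>1"
    and e2: "\<And>m. m < M2 \<Longrightarrow> measure (noise N k) {z \<in> space (noise N k). d2 (\<lambda>j\<in>{..<k}. v m j + z j) \<noteq> m} \<le> \<epsilon>2"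
  shows "err_prob N n pc \<le> \<epsilon>1 + \<epsilon>2"
proof -
  interpret prob_space "noise N n" using N by (rule prob_space_noise)
  have rot: "measure (noise N n) {z \<in> space (noise N n). d (\<lambda>j\<in>{..<k}. x j + (c * z (2 * j) + s * z (2 * j + 1))) \<noteq> m} =
      measure (noise N k) {z \<in> space (noise N k). d (\<lambda>j\<in>{..<k}. x j + z j) \<noteq> m}"
    and rot_sets: "{z \<in> space (noise N n). d (\<lambda>j\<in>{..<k}. x j + (c * z (2 * j) + s * z (2 * j + 1))) \<noteq> m} \<in> events"
    if cs: "c\<^sup>2 + s\<^sup>2 = 1" "c \<noteq> 0" "s \<noteq> 0" and d: "d \<in> measurable (PiM {..<k} (\<lambda>_. borel)) (count_space UNIV)"
    for c s x and d :: "(nat \<Rightarrow> real) \<Rightarrow> nat" and m :: nat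
  proof -
    let ?E = "{z \<in> space (noise N n). d (\<lambda>j\<in>{..<k}. x j + (c * z (2 * j) + s * z (2 * j + 1))) \<noteq> m}"
    let ?F = "{z \<in> space (noise N k). d (\<lambda>j\<in>{..<k}. x j + z j) \<noteq> m}"
    let ?r = "\<lambda>z. \<lambda>j\<in>{..<k}. c * z (2 * j) + s * z (2 * j + 1) :: real"
    have r: "?r \<in> measurable (noise N n) (PiM {..<k} (\<lambda>_. borel))"
    proof (rule measurable_restrict)
      fix j assume "j \<in> {..<k}"
      then have "2 * j \<in> {..<n}" "2 * j + 1 \<in> {..<n}" using k by auto
      then show "(\<lambda>z. c * z (2 * j) + s * z (2 * j + 1)) \<in> borel_measurable (noise N n)" by measurable
    qed
    have F: "?F \<in> sets (PiM {..<k} (\<lambda>_. borel))"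
    proof -
      have "(\<lambda>z. d (\<lambda>j\<in>{..<k}. x j + z j)) \<in> measurable (noise N k) (count_space UNIV)"
        using measurable_compose[OF measurable_shift d] by simp
      then have "?F \<in> sets (noise N k)" by measurable
      then show ?thesis by simp
    qed
    have E: "?E = ?r -` ?F \<inter> space (noise N n)"
      by (auto simp: space_noise cong: restrict_cong)
    show "?E \<in> events" unfolding E using r F by (rule measurable_sets)
    have "measure (noise N k) ?F = measure (distr (noise N n) (PiM {..<k} (\<lambda>_. borel)) ?r) ?F"
      using noise_rotation[OF N cs k(2,1)] by simp
    also have "\<dots> = measure (noise N n) ?E"
      unfolding E using r F by (rule measure_distr)
    finally show "measure (noise N n) ?E = measure (noise N k) ?F" ..
  qed
  have \<sigma>0: "\<sigma> \<noteq> 0" using \<sigma> by auto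
  have cs: "(\<sigma> * (4 / 5))\<^sup>2 + (\<sigma> * (3 / 5))\<^sup>2 = 1" "(3 / 5)\<^sup>2 + (- 4 / 5 :: real)\<^sup>2 = 1"
    unfolding power_mult_distrib \<sigma> by (simp_all add: power2_eq_square)
  have one: "measure (noise N n) {z \<in> space (noise N n). dec pc (restrict (outp pc a b z n) {..<n}) \<noteq> (a, b)} \<le> \<epsilon>1 + \<epsilon>2"
    if ab: "a < M1" "b < M2" for a b
  proof -
    let ?E1 = "{z \<in> space (noise N n). d1 (\<lambda>j\<in>{..<k}. u a j + (\<sigma> * (4 / 5) * z (2 * j) + \<sigma> * (3 / 5) * z (2 * j + 1))) \<noteq> a}"
    let ?E2 = "{z \<in> space (noise N n). d2 (\<lambda>j\<in>{..<k}. v b j + (3 / 5 * z (2 * j) + - 4 / 5 * z (2 * j + 1))) \<noteq> b}"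
    have E: "?E1 \<in> events" "?E2 \<in> events"
      by (rule rot_sets[OF cs(1) _ _ d1], use \<sigma>0 in simp, use \<sigma>0 in simp)
        (rule rot_sets[OF cs(2) _ _ d2]; simp)
    have "{z \<in> space (noise N n). dec pc (restrict (outp pc a b z n) {..<n}) \<noteq> (a, b)} = ?E1 \<union> ?E2"
      unfolding pair_code_dec[OF \<sigma> k(1)] by blast
    then have "measure (noise N n) {z \<in> space (noise N n). dec pc (restrict (outp pc a b z n) {..<n}) \<noteq> (a, b)} \<le>
        measure (noise N n) ?E1 + measure (noise N n) ?E2"
      using measure_Un_le[OF E] by simp
    also have "measure (noise N n) ?E1 = measure (noise N k) {z \<in> space (noise N k). d1 (\<lambda>j\<in>{..<k}. u a j + z j) \<noteq> a}"
      by (rule rot[OF cs(1) _ _ d1]) (use \<sigma>0 in simp_all)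
    also have "measure (noise N n) ?E2 = measure (noise N k) {z \<in> space (noise N k). d2 (\<lambda>j\<in>{..<k}. v b j + z j) \<noteq> b}"
      by (rule rot[OF cs(2) _ _ d2]) simp_all
    finally show ?thesis using e1[OF ab(1)] e2[OF ab(2)] by linarith
  qed
  have "(\<Sum>a<M1. \<Sum>b<M2. measure (noise N n)
      {z \<in> space (noise N n). dec pc (restrict (outp pc a b z n) {..<n}) \<noteq> (a, b)}) \<le> (\<Sum>a<M1. \<Sum>b<M2. \<epsilon>1 + \<epsilon>2)"
    by (intro sum_mono one) auto
  also have "\<dots> = (\<epsilon>1 + \<epsilon>2) * (real M1 * real M2)" by simp
  finally show ?thesis
    unfolding err_prob_def using M by (simp add: pair_code_sel pos_divide_le_eq)
qed

end

section \<open>Power budget of the two-use code\<close>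

text \<open>Groups the time slots into pairs; when \<open>n\<close> is odd and
  \<open>k = n div 2\<close>, the last slot is silent.\<close>

lemma sum_lessThan_double:
  fixes f :: "nat \<Rightarrow> 'a :: comm_monoid_add"
  assumes "2 * k \<le> n" "\<And>t. 2 * k \<le> t \<Longrightarrow> f t = 0"
  shows "(\<Sum>t<n. f t) = (\<Sum>j<k. f (2 * j) + f (2 * j + 1))"
proof -
  have "(\<Sum>t<n. f t) = (\<Sum>t<2 * k. f t)"
    using assms by (intro sum.mono_neutral_right) auto
  also have "\<dots> = (\<Sum>j<k. f (2 * j) + f (2 * j + 1))"
    by (induction k) (simp_all add: add.assoc)
  finally show ?thesis .
qed

lemma noise_affine_second_moment:
  assumes "0 < N" "j < n"
  shows "(\<integral>\<^sup>+z. ennreal ((x + c * z j)\<^sup>2) \<partial>noise N n) = ennreal (x\<^sup>2 + c\<^sup>2 * N)"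
proof -
  interpret G: prob_space "gauss N" using assms by (intro prob_space_gauss)
  have "has_bochner_integral (gauss N) (\<lambda>w. x\<^sup>2) (x\<^sup>2)"
    using has_bochner_integral_integrable[of "gauss N" "\<lambda>w. x\<^sup>2"] G.prob_space by simp
  then have "has_bochner_integral (gauss N) (\<lambda>w. x\<^sup>2 + 2 * x * c * w + c\<^sup>2 * w\<^sup>2) (x\<^sup>2 + 2 * x * c * 0 + c\<^sup>2 * N)"
    by (intro has_bochner_integral_add has_bochner_integral_mult_right gauss_moment_1 gauss_moment_2 assms)
  then have "has_bochner_integral (gauss N) (\<lambda>w. (x + c * w)\<^sup>2) (x\<^sup>2 + c\<^sup>2 * N)"
    by (simp add: power2_eq_square algebra_simps)
  from noise_component[OF assms this] show ?thesis
    by (subst nn_integral_eq_integral) (auto simp: has_bochner_integral_iff)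
qed

text \<open>Transmitter 1 spends at most 2 per pair of uses, exactly its budget. For transmitter 2
  the only term of indefinite sign is the correlation of \<open>u\<close> and \<open>v\<close>;
  averaged over independent messages it becomes a product of codebook sums, and \<open>corr\<close>
  makes its contribution nonpositive.\<close>

lemma pair_code_valid:
  fixes u v :: "nat \<Rightarrow> nat \<Rightarrow> real"
  assumes \<sigma>: "\<sigma>\<^sup>2 = 1" and k: "2 * k \<le> n" and M: "0 < M1" "0 < M2"
    and d1: "d1 \<in> measurable (PiM {..<k} (\<lambda>_. borel)) (count_space UNIV)"
    and d2: "d2 \<in> measurable (PiM {..<k} (\<lambda>_. borel)) (count_space UNIV)"
    and u: "\<And>a. a < M1 \<Longrightarrow> (\<Sum>j<k. (u a j)\<^sup>2) \<le> real k * 2"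
    and v: "\<And>b. b < M2 \<Longrightarrow> (\<Sum>j<k. (v b j)\<^sup>2) \<le> real k * (55 / 4)"
    and corr: "0 \<le> \<sigma> * (\<Sum>j<k. (\<Sum>a<M1. u a j) * (\<Sum>b<M2. v b j))"
  shows "valid_code 1 5 5 n (pair_code \<sigma> k M1 M2 u v d1 d2)" (is "valid_code _ _ _ _ ?c")
  unfolding valid_code_def pair_code_sel(1,2)
proof (intro conjI allI impI)
  show "1 \<le> M1" "1 \<le> M2" using M by auto
next
  fix t b assume "t < n" "b < M2"
  have "enc2 ?c t b = (\<lambda>y. if t < 2 * k then
     (if even t then 3 / 5 * v b (t div 2) else - 4 / 5 * v b (t div 2) + 3 / 5 * y (t - 1)) else 0)"
    by (simp add: pair_code_sel fun_eq_iff)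
  \<comment> \<open>Oddness excludes \<open>t = 0\<close>, so \<open>t - 1\<close> really is a past
    time index.\<close>
  moreover have "(\<lambda>y. y (t - 1)) \<in> borel_measurable (PiM {..<t} (\<lambda>_. borel :: real measure))" if "odd t"
    using that by (intro measurable_component_singleton) (auto elim: oddE)
  ultimately show "enc2 ?c t b \<in> borel_measurable (PiM {..<t} (\<lambda>_. borel))"
    by (cases "even t"; cases "t < 2 * k") simp_all
next
  have [measurable]: "2 * j \<in> {..<n}" "2 * j + 1 \<in> {..<n}" "Suc (2 * j) \<in> {..<n}" if "j \<in> {..<k}" for j
    using that k by auto
  have 1: "(\<lambda>y. \<lambda>j\<in>{..<k}. \<sigma> * (4 / 5 * y (2 * j) + 3 / 5 * (y (2 * j + 1) - 3 / 5 * y (2 * j))))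
      \<in> measurable (PiM {..<n} (\<lambda>_. borel)) (PiM {..<k} (\<lambda>_. borel :: real measure))"
    by (rule measurable_restrict) measurable
  have 2: "(\<lambda>y. \<lambda>j\<in>{..<k}. 3 / 5 * y (2 * j) - 4 / 5 * (y (2 * j + 1) - 3 / 5 * y (2 * j)))
      \<in> measurable (PiM {..<n} (\<lambda>_. borel)) (PiM {..<k} (\<lambda>_. borel :: real measure))"
    by (rule measurable_restrict) measurable
  have "dec ?c \<in> measurable (PiM {..<n} (\<lambda>_. borel)) (count_space UNIV \<Otimes>\<^sub>M count_space UNIV)"
    unfolding pair_code_def fbcode.simps
    by (intro measurable_Pair measurable_compose[OF 1 d1] measurable_compose[OF 2 d2])
  then show "dec ?c \<in> measurable (PiM {..<n} (\<lambda>_. borel)) (count_space UNIV)"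
    by (simp add: pair_measure_countable)
next
  have "(\<Sum>t<n. (\<Sum>a<M1. (enc1 ?c t a)\<^sup>2) / real M1) = (\<Sum>j<k. (\<Sum>a<M1. (u a j)\<^sup>2) / real M1)"
    by (subst sum_lessThan_double[OF k])
      (auto simp: pair_code_sel power_mult_distrib \<sigma> add_divide_distrib[symmetric] sum.distrib[symmetric]
        power_divide intro!: sum.cong arg_cong[where f="\<lambda>x. x / real M1"])
  also have "\<dots> = (\<Sum>a<M1. \<Sum>j<k. (u a j)\<^sup>2) / real M1"
    by (subst sum.swap) (simp add: sum_divide_distrib)
  also have "\<dots> \<le> (\<Sum>a<M1. real k * 2) / real M1"
    using u by (intro divide_right_mono sum_mono) auto
  also have "\<dots> \<le> real n * 1"
    using M k by simp
  finally show "(\<Sum>t<n. (\<Sum>a<M1. (enc1 ?c t a)\<^sup>2) / real M1) \<le> real n * 1" .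
next
  let ?I = "\<lambda>t a b. \<integral>\<^sup>+ z. ennreal ((x2 ?c a b z t)\<^sup>2) \<partial>noise 5 n"
  let ?w = "\<lambda>a b j. 12 / 25 * \<sigma> * u a j - 11 / 25 * v b j"
  interpret prob_space "noise 5 n" by (rule prob_space_noise) simp
  have even: "?I (2 * j) a b = ennreal (9 / 25 * (v b j)\<^sup>2)" if "j < k" for j a b
    unfolding pair_code_x2 using that emeasure_space_1 by (simp add: power_mult_distrib power_divide)
  have odd: "?I (2 * j + 1) a b = ennreal ((?w a b j)\<^sup>2 + 9 / 5)" if "j < k" for j a b
    unfolding pair_code_x2 using that k noise_affine_second_moment[of 5 "2 * j" n "?w a b j" "3 / 5"]
    by (simp add: power_divide)
  have zero: "x2 ?c a b z t = 0" if "2 * k \<le> t" for a b z t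
    using that by (simp add: x2_def pair_code_sel)
  have "(\<Sum>t<n. \<Sum>a<M1. \<Sum>b<M2. ?I t a b) =
      (\<Sum>j<k. (\<Sum>a<M1. \<Sum>b<M2. ?I (2 * j) a b) + (\<Sum>a<M1. \<Sum>b<M2. ?I (2 * j + 1) a b))"
    by (rule sum_lessThan_double[OF k]) (simp add: zero)
  also have "\<dots> = (\<Sum>j<k. \<Sum>a<M1. \<Sum>b<M2. ?I (2 * j) a b + ?I (2 * j + 1) a b)"
    by (simp add: sum.distrib)
  also have "\<dots> = (\<Sum>j<k. \<Sum>a<M1. \<Sum>b<M2. ennreal (9 / 25 * (v b j)\<^sup>2 + ((?w a b j)\<^sup>2 + 9 / 5)))"
  proof (intro sum.cong refl)
    fix j a b assume "j \<in> {..<k}"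
    then have j: "j < k" by simp
    show "?I (2 * j) a b + ?I (2 * j + 1) a b = ennreal (9 / 25 * (v b j)\<^sup>2 + ((?w a b j)\<^sup>2 + 9 / 5))"
      unfolding even[OF j] odd[OF j] by (rule ennreal_plus[symmetric]) auto
  qed
  also have "\<dots> = ennreal (\<Sum>j<k. \<Sum>a<M1. \<Sum>b<M2. 9 / 25 * (v b j)\<^sup>2 + ((?w a b j)\<^sup>2 + 9 / 5))"
    by (simp add: sum_nonneg del: ennreal_plus)
  also have "\<dots> \<le> ennreal (real n * real M1 * real M2 * 5)"
  proof (rule ennreal_leI)
    define X where "X = (\<Sum>j<k. (\<Sum>a<M1. u a j) * (\<Sum>b<M2. v b j))"
    have X_eq: "X = (\<Sum>j<k. \<Sum>a<M1. \<Sum>b<M2. u a j * v b j)"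
      unfolding X_def by (simp only: sum_product)
    \<comment> \<open>Here \<open>346 / 625 = 9 / 25 + 121 / 625\<close> is the total weight of
      \<open>v\<close> over both uses, and \<open>9 / 5\<close> is the power of the fed-back
      noise.\<close>
    have w: "9 / 25 * (v b j)\<^sup>2 + ((?w a b j)\<^sup>2 + 9 / 5) =
        346 / 625 * (v b j)\<^sup>2 + 144 / 625 * (u a j)\<^sup>2 + 9 / 5 - 264 / 625 * \<sigma> * (u a j * v b j)" for a b j
    proof -
      have "(?w a b j)\<^sup>2 = 144 / 625 * \<sigma>\<^sup>2 * (u a j)\<^sup>2 - 264 / 625 * \<sigma> * (u a j * v b j) + 121 / 625 * (v b j)\<^sup>2"
        by (simp add: power2_eq_square field_simps)
      then show ?thesis unfolding \<sigma> by simp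
    qed
    have U: "(\<Sum>j<k. \<Sum>a<M1. (u a j)\<^sup>2) \<le> real M1 * (real k * 2)"
    proof (subst sum.swap)
      have "(\<Sum>a<M1. \<Sum>j<k. (u a j)\<^sup>2) \<le> (\<Sum>a<M1. real k * 2)" using u by (intro sum_mono) auto
      then show "(\<Sum>a<M1. \<Sum>j<k. (u a j)\<^sup>2) \<le> real M1 * (real k * 2)" by simp
    qed
    have V: "(\<Sum>j<k. \<Sum>b<M2. (v b j)\<^sup>2) \<le> real M2 * (real k * (55 / 4))"
    proof (subst sum.swap)
      have "(\<Sum>b<M2. \<Sum>j<k. (v b j)\<^sup>2) \<le> (\<Sum>b<M2. real k * (55 / 4))" using v by (intro sum_mono) auto
      then show "(\<Sum>b<M2. \<Sum>j<k. (v b j)\<^sup>2) \<le> real M2 * (real k * (55 / 4))" by simp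
    qed
    have "(\<Sum>j<k. \<Sum>a<M1. \<Sum>b<M2. 9 / 25 * (v b j)\<^sup>2 + ((?w a b j)\<^sup>2 + 9 / 5)) =
        346 / 625 * (real M1 * (\<Sum>j<k. \<Sum>b<M2. (v b j)\<^sup>2)) + 144 / 625 * (real M2 * (\<Sum>j<k. \<Sum>a<M1. (u a j)\<^sup>2))
        + 9 / 5 * (real k * real M1 * real M2) - 264 / 625 * (\<sigma> * X)"
      unfolding w X_eq by (simp add: sum.distrib sum_subtractf sum_distrib_left sum_divide_distrib mult_ac)
    also have "\<dots> \<le> 346 / 625 * (real M1 * (real M2 * (real k * (55 / 4)))) + 144 / 625 * (real M2 * (real M1 * (real k * 2)))
        + 9 / 5 * (real k * real M1 * real M2) - 264 / 625 * 0"
      using corr unfolding X_def[symmetric]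
      by (intro diff_mono add_mono mult_left_mono U V order_refl) auto
    also have "\<dots> = (346 / 625 * (55 / 4) + 144 / 625 * 2 + 9 / 5) * k * (real M1 * real M2)"
      by (simp add: algebra_simps)
    \<comment> \<open>The constant is 9.8728 per pair, within the budget of 10 for two uses.\<close>
    also have "\<dots> \<le> (real n * 5) * (real M1 * real M2)"
      using k by (intro mult_right_mono) auto
    finally show "(\<Sum>j<k. \<Sum>a<M1. \<Sum>b<M2. 9 / 25 * (v b j)\<^sup>2 + ((?w a b j)\<^sup>2 + 9 / 5)) \<le> real n * real M1 * real M2 * 5"
      by (simp add: mult_ac)
  qed
  finally show "(\<Sum>t<n. \<Sum>a<M1. \<Sum>b<M2. ?I t a b) \<le> ennreal (real n * real M1 * real M2 * 5)" .
qed

section \<open>Achievability of the rate pair\<close>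

lemma rate_bound:
  assumes "exp (real (n div 2) * r) \<le> real M" "0 \<le> r" "2 * R - \<delta> \<le> r" "r < \<delta> * real n" "0 < n"
  shows "ln (real M) / real n > R - \<delta>"
proof -
  have "real (n div 2) * r \<le> ln (real M)"
    using assms(1) by (subst ln_exp[symmetric]) (rule ln_mono; use assms(1) exp_gt_zero less_le_trans in blast)
  moreover have "(real n - 1) / 2 * r \<le> real (n div 2) * r"
  proof (rule mult_right_mono)
    have "real n \<le> 2 * real (n div 2) + 1" by linarith
    then show "(real n - 1) / 2 \<le> real (n div 2)" by simp
  qed fact
  moreover have "(R - \<delta>) * real n < (real n - 1) / 2 * r"
  proof -
    have "real n * (2 * R - \<delta>) \<le> real n * r" using assms by (intro mult_left_mono) auto
    then show ?thesis using assms(4) by (simp add: algebra_simps)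
  qed
  ultimately show ?thesis using assms(5) by (simp add: pos_less_divide_eq)
qed

lemma achievable_pair_code_rates: "achievable 1 5 5 (ln (7 / 5) / 4, ln (15 / 4) / 4)"
  unfolding achievable_def
proof (intro allI impI)
  fix \<delta> :: real assume \<delta>: "0 < \<delta>"
  \<comment> \<open>Rates strictly below the single-user capacities at powers 2 and
    \<open>55 / 4\<close>; truncation at 0 keeps \<open>awgn_code\<close> applicable when
    \<open>\<delta>\<close> is large.\<close>
  define r1 where "r1 = max 0 (ln (7 / 5) / 2 - \<delta>)"
  define r2 where "r2 = max 0 (ln (15 / 4) / 2 - \<delta>)"
  have r: "0 \<le> r1" "0 \<le> r2" "r1 < ln (1 + 2 / 5) / 2" "r2 < ln (1 + (55 / 4) / 5) / 2"
    using \<delta> by (auto simp: r1_def r2_def max_def)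
  obtain C1 where C1: "\<forall>\<^sub>F k in sequentially. \<exists>M x d. exp (k * r1) \<le> real M \<and> (\<forall>m<M. (\<Sum>j<k. (x m j)\<^sup>2) \<le> real k * 2) \<and>
    d \<in> measurable (PiM {..<k} (\<lambda>_. borel)) (count_space UNIV) \<and>
    (\<forall>m<M. measure (noise 5 k) {z \<in> space (noise 5 k). d (\<lambda>j\<in>{..<k}. x m j + z j) \<noteq> m} \<le> C1 / k)"
    using awgn_code[of 2 5 r1] r by auto
  obtain C2 where C2: "\<forall>\<^sub>F k in sequentially. \<exists>M x d. exp (k * r2) \<le> real M \<and> (\<forall>m<M. (\<Sum>j<k. (x m j)\<^sup>2) \<le> real k * (55 / 4)) \<and>
    d \<in> measurable (PiM {..<k} (\<lambda>_. borel)) (count_space UNIV) \<and>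
    (\<forall>m<M. measure (noise 5 k) {z \<in> space (noise 5 k). d (\<lambda>j\<in>{..<k}. x m j + z j) \<noteq> m} \<le> C2 / k)"
    using awgn_code[of "55 / 4" 5 r2] r by auto
  define good where "good n c \<longleftrightarrow> valid_code 1 5 5 n c \<and>
      ln (real (msz1 c)) / real n > ln (7 / 5) / 4 - \<delta> \<and>
      ln (real (msz2 c)) / real n > ln (15 / 4) / 4 - \<delta> \<and>
      err_prob 5 n c \<le> (C1 + C2) / real (n div 2)" for n c
  have half: "filterlim (\<lambda>n::nat. n div 2) sequentially sequentially"
    unfolding filterlim_at_top
  proof
    fix Z :: nat
    show "\<forall>\<^sub>F n in sequentially. Z \<le> n div 2"
      using eventually_ge_at_top[of "2 * Z"] by eventually_elim linarith
  qed
  have "\<forall>\<^sub>F n::nat in sequentially. r1 < \<delta> * real n" "\<forall>\<^sub>F n::nat in sequentially. r2 < \<delta> * real n"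
    using \<delta> by real_asymp+
  then have ev: "\<forall>\<^sub>F n in sequentially. \<exists>c. good n c"
    using eventually_compose_filterlim[OF C1 half] eventually_compose_filterlim[OF C2 half]
      eventually_ge_at_top[of 2]
  proof eventually_elim
    case (elim n)
    let ?k = "n div 2"
    obtain M1 u d1 where 1: "exp (?k * r1) \<le> real M1" "\<And>m. m < M1 \<Longrightarrow> (\<Sum>j<?k. (u m j)\<^sup>2) \<le> real ?k * 2"
      "d1 \<in> measurable (PiM {..<?k} (\<lambda>_. borel)) (count_space UNIV)"
      "\<And>m. m < M1 \<Longrightarrow> measure (noise 5 ?k) {z \<in> space (noise 5 ?k). d1 (\<lambda>j\<in>{..<?k}. u m j + z j) \<noteq> m} \<le> C1 / ?k"
      using elim(3) by blast
    obtain M2 v d2 where 2: "exp (?k * r2) \<le> real M2" "\<And>m. m < M2 \<Longrightarrow> (\<Sum>j<?k. (v m j)\<^sup>2) \<le> real ?k * (55 / 4)"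
      "d2 \<in> measurable (PiM {..<?k} (\<lambda>_. borel)) (count_space UNIV)"
      "\<And>m. m < M2 \<Longrightarrow> measure (noise 5 ?k) {z \<in> space (noise 5 ?k). d2 (\<lambda>j\<in>{..<?k}. v m j + z j) \<noteq> m} \<le> C2 / ?k"
      using elim(4) by blast
    have M: "0 < M1" "0 < M2"
      using less_le_trans[OF exp_gt_zero 1(1)] less_le_trans[OF exp_gt_zero 2(1)] by auto
    have k: "2 * ?k \<le> n" "0 < ?k" using elim(5) by auto
    \<comment> \<open>Flipping the sign of the whole first codebook changes neither its power nor
      its error probability, but makes the correlation term favourable.\<close>
    define \<sigma> :: real where "\<sigma> = (if 0 \<le> (\<Sum>j<?k. (\<Sum>a<M1. u a j) * (\<Sum>b<M2. v b j)) then 1 else - 1)"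
    have \<sigma>: "\<sigma>\<^sup>2 = 1" "0 \<le> \<sigma> * (\<Sum>j<?k. (\<Sum>a<M1. u a j) * (\<Sum>b<M2. v b j))"
      by (auto simp: \<sigma>_def)
    let ?c = "pair_code \<sigma> ?k M1 M2 u v d1 d2"
    have "err_prob 5 n ?c \<le> C1 / ?k + C2 / ?k"
      by (rule pair_code_err_prob[OF \<sigma>(1) k _ M 1(3) 2(3) 1(4) 2(4)]) simp_all
    moreover have "valid_code 1 5 5 n ?c"
      by (rule pair_code_valid[OF \<sigma>(1) k(1) M 1(3) 2(3) 1(2) 2(2) \<sigma>(2)])
    moreover have "ln (real M1) / real n > ln (7 / 5) / 4 - \<delta>"
      by (rule rate_bound[OF 1(1) r(1) _ elim(1)]) (use elim(5) in \<open>auto simp: r1_def\<close>)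
    moreover have "ln (real M2) / real n > ln (15 / 4) / 4 - \<delta>"
      by (rule rate_bound[OF 2(1) r(2) _ elim(2)]) (use elim(5) in \<open>auto simp: r2_def\<close>)
    ultimately have "good n ?c"
      by (simp add: good_def pair_code_sel add_divide_distrib)
    then show ?case ..
  qed
  \<comment> \<open>For the finitely many \<open>n\<close> that may lack a good code the value is
    arbitrary; achievability constrains only large \<open>n\<close>.\<close>
  define c where "c n = (SOME c. good n c)" for n
  have good: "\<forall>\<^sub>F n in sequentially. good n (c n)"
    using ev by eventually_elim (auto simp: c_def intro: someI_ex)
  have "(\<lambda>n. err_prob 5 n (c n)) \<longlonglongrightarrow> 0"
  proof (rule tendsto_sandwich)
    show "\<forall>\<^sub>F n in sequentially. 0 \<le> err_prob 5 n (c n)"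
      by (simp add: err_prob_def sum_nonneg)
    show "\<forall>\<^sub>F n in sequentially. err_prob 5 n (c n) \<le> (C1 + C2) / real (n div 2)"
      using good by eventually_elim (simp add: good_def)
    have "(\<lambda>k. (C1 + C2) / real k) \<longlonglongrightarrow> 0"
      by (rule lim_const_over_n)
    then show "(\<lambda>n. (C1 + C2) / real (n div 2)) \<longlonglongrightarrow> 0"
      using half by (rule filterlim_compose)
  qed simp
  moreover obtain n0 where "\<forall>n\<ge>n0. good n (c n)"
    using good by (auto simp: eventually_sequentially)
  ultimately show "\<exists>c. (\<exists>n0. \<forall>n\<ge>n0. valid_code 1 5 5 n (c n) \<and>
      ln (real (msz1 (c n))) / real n > fst (ln (7 / 5) / 4, ln (15 / 4) / 4) - \<delta> \<and>
      ln (real (msz2 (c n))) / real n > snd (ln (7 / 5) / 4, ln (15 / 4) / 4) - \<delta>) \<and>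
    (\<lambda>n. err_prob 5 n (c n)) \<longlonglongrightarrow> 0"
    by (intro exI[of _ c] conjI exI[of _ n0]) (auto simp: good_def)
qed

section \<open>Violation of the Cover-Leung constraints\<close>

lemma le_power2_if_ln_le:
  fixes x y :: real
  assumes "ln x / 4 \<le> ln y / 2" "0 < x" "0 < y"
  shows "x \<le> y\<^sup>2"
proof -
  have "ln x \<le> ln (y\<^sup>2)" using assms by (simp add: ln_realpow)
  then show ?thesis using assms by simp
qed

lemma not_in_cover_leung: "(ln (7 / 5) / 4, ln (15 / 4) / 4) \<notin> R_CL 1 5 5"
proof
  assume "(ln (7 / 5) / 4, ln (15 / 4) / 4) \<in> R_CL 1 5 5"
  then obtain \<rho>1 \<rho>2 :: real where \<rho>: "0 \<le> \<rho>1" "\<rho>1 \<le> 1" "0 \<le> \<rho>2" "\<rho>2 \<le> 1"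
    and R1: "ln (7 / 5) / 4 \<le> ln (1 + (1 - \<rho>1\<^sup>2) / 5) / 2"
    and R2: "ln (15 / 4) / 4 \<le> ln (1 + 5 * (1 - \<rho>2\<^sup>2) / 5) / 2"
    and R12: "ln (7 / 5) / 4 + ln (15 / 4) / 4 \<le> ln (1 + (6 + 2 * sqrt 5 * \<rho>1 * \<rho>2) / 5) / 2"
    by (auto simp: R_CL_def R_CL_rho_def)
  have sq: "\<rho>1\<^sup>2 \<le> 1" "\<rho>2\<^sup>2 \<le> 1" using \<rho> by (simp_all add: power_le_one)
  have "7 / 5 \<le> (1 + (1 - \<rho>1\<^sup>2) / 5)\<^sup>2"
    using sq by (intro le_power2_if_ln_le R1) (auto intro: add_pos_nonneg)
  \<comment> \<open>At \<open>\<rho>1\<^sup>2 = 17 / 200\<close> the base equals 1.183, and its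
    square 1.399489 just misses \<open>7 / 5\<close>.\<close>
  moreover have "(1 + (1 - \<rho>1\<^sup>2) / 5)\<^sup>2 \<le> (1183 / 1000)\<^sup>2" if "\<rho>1\<^sup>2 > 17 / 200"
    using that sq by (intro power_mono) auto
  ultimately have x: "\<rho>1\<^sup>2 \<le> 17 / 200"
    by (cases "\<rho>1\<^sup>2 \<le> 17 / 200") (auto simp: power2_eq_square)
  have "15 / 4 \<le> (1 + 5 * (1 - \<rho>2\<^sup>2) / 5)\<^sup>2"
    using sq by (intro le_power2_if_ln_le R2) (auto intro: add_pos_nonneg)
  \<comment> \<open>At \<open>\<rho>2\<^sup>2 = 8 / 125\<close> the base equals 1.936, and its
    square 3.748096 just misses \<open>15 / 4\<close>.\<close>
  moreover have "(1 + 5 * (1 - \<rho>2\<^sup>2) / 5)\<^sup>2 \<le> (1936 / 1000)\<^sup>2" if "\<rho>2\<^sup>2 > 8 / 125"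
    using that sq by (intro power_mono) auto
  ultimately have y: "\<rho>2\<^sup>2 \<le> 8 / 125"
    by (cases "\<rho>2\<^sup>2 \<le> 8 / 125") (auto simp: power2_eq_square)
  have pos: "0 \<le> 2 * sqrt 5 * \<rho>1 * \<rho>2" using \<rho> by simp
  have "(2 * sqrt 5 * \<rho>1 * \<rho>2)\<^sup>2 = 20 * (\<rho>1\<^sup>2 * \<rho>2\<^sup>2)"
    by (simp add: power_mult_distrib)
  also have "\<dots> \<le> 20 * (17 / 200 * (8 / 125))"
    using x y by (intro mult_left_mono mult_mono) auto
  \<comment> \<open>Numerically \<open>0.1088 \<le> 0.1225\<close>; the value \<open>7 / 20\<close>
    is a convenient rational upper bound that still suffices below.\<close>
  also have "\<dots> \<le> (7 / 20)\<^sup>2" by (simp add: power2_eq_square)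
  finally have xy: "2 * sqrt 5 * \<rho>1 * \<rho>2 \<le> 7 / 20"
    by (rule power2_le_imp_le) simp
  have "ln (7 / 5) + ln (15 / 4) = ln (21 / 4 :: real)"
    using ln_mult[of "7 / 5" "15 / 4 :: real"] by simp
  then have "ln (21 / 4) / 4 \<le> ln (1 + (6 + 2 * sqrt 5 * \<rho>1 * \<rho>2) / 5) / 2"
    using R12 by (simp add: add_divide_distrib[symmetric])
  then have "21 / 4 \<le> (1 + (6 + 2 * sqrt 5 * \<rho>1 * \<rho>2) / 5)\<^sup>2"
    using pos by (intro le_power2_if_ln_le) (auto intro: add_pos_nonneg)
  also have "\<dots> \<le> (1 + (6 + 7 / 20) / 5)\<^sup>2"
    by (intro power_mono add_left_mono divide_right_mono xy add_nonneg_nonneg divide_nonneg_nonneg pos) simp_all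
  \<comment> \<open>The square of 2.27 is 5.1529, below 5.25, so the sum-rate constraint is
    violated.\<close>
  also have "\<dots> < 21 / 4" by (simp add: power2_eq_square)
  finally show False by simp
qed

theorem mainTheorem11:
  shows "(\<exists>R \<in> C_PerfectPartialFB 1 5 5. R \<notin> R_CL 1 5 5) \<and> R_CL 1 5 5 \<noteq> C_PerfectPartialFB 1 5 5"
proof -
  have "(ln (7 / 5) / 4, ln (15 / 4) / 4) \<in> C_PerfectPartialFB 1 5 5"
    using achievable_pair_code_rates by (simp add: C_PerfectPartialFB_def)
  with not_in_cover_leung show ?thesis by blast
qed

end
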